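(* Let $q_1,q_2$ be integers with $1\le q_1\le q_2$, let $A=\begin{pmatrix}3q_1&0\\0&3q_2\end{pmatrix}$, $\mathcal{D}=\left\{\begin{pmatrix}0\\0\end{pmatrix},\begin{pmatrix}1\\0\end{pmatrix},\begin{pmatrix}0\\1\end{pmatrix}\right\}$, and let $\mu_{A,\mathcal{D}}$ be the Sierpiński-type self-affine measure defined below. Let $\Lambda$ be a countable subset of $\mathbb{R}^2$ containing $\mathbf{0}$. Then $\Lambda$ is a maximal orthogonal set of $\mu_{A,\mathcal{D}}$ if and only if there exists a maximal tree mapping $\tau$ such that $\Lambda=\tau^*(\Theta_3^\tau)$.
   Context: $\mu_{A,\mathcal{D}}$ is the unique Borel probability measure on $\mathbb{R}^2$ satisfying $\mu_{A,\mathcal{D}}(E)=\frac13\sum_{d\in\mathcal{D}}\mu_{A,\mathcal{D}}(AE-d)$ for all Borel sets $E$. A countable set $\Lambda\subseteq\mathbb{R}^2$ is an orthogonal set of a probability measure $\mu$ if the functions $e_\lambda(x)=e^{-2\pi i\langle\lambda,x\rangle}$, $\lambda\in\Lambda$, are mutually orthogonal in $L^2(\mu)$; it is a maximal orthogonal set if it is an orthogonal set not properly contained in any other orthogonal set of $\mu$. Notation: $\Gamma_{q_1,q_2}=\{(k,l)^T\in\mathbb{Z}^2: -\frac{3q_1}{2}\le k<\frac{3q_1}{2},\ -\frac{3q_2}{2}\le l<\frac{3q_2}{2}\}$ (a complete residue system of $\mathbb{Z}^2$ modulo $A\mathbb{Z}^2$); for $x,y\in\mathbb{Z}^2$, $x\equiv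 y\pmod A$ means $x-y\in A\mathbb{Z}^2$. $\mathcal{E}_{q_1}=\{(a_1,a_2)^T\in\Gamma_{q_1,q_2}: -\frac{q_1}{2}\le a_1<\frac{q_1}{2}\}$. $\Theta_3=\{-1,0,1\}$, $\Theta_3^n$ the words of length $n$ over $\Theta_3$, $\Theta_3^*=\bigcup_{n\ge1}\Theta_3^n$, $\Theta_3^\infty$ the infinite words; $IJ$ denotes concatenation, $0^k$ the word of $k$ zeros, $I|_k$ the prefix of length $k$. A maximal tree mapping is a map $\tau:\Theta_3^*\to\Gamma_{q_1,q_2}$ such that: (i) $\tau(0^k i)=i\begin{pmatrix}q_1\\-q_2\end{pmatrix}$ for all $k\ge0$ and $i\in\Theta_3$ (with $0^0i=i$); (ii) for every $k\ge1$ and every $I\in\Theta_3^k$ with $I\ne0^k$ there is $e_I\in\mathcal{E}_{q_1}$ such that $\tau(Ij)\equiv e_I+j\begin{pmatrix}q_1\\-q_2\end{pmatrix}\pmod A$ for all $j\in\Theta_3$; (iii) for every $I\in\Theta_3^*$ there exists $J\in\Theta_3^*$ such that $\tau(IJ0^n)=\mathbf{0}$ for all sufficiently large $n$. For such $\tau$, $\Theta_3^\tau=\{I\in\Theta_3^\infty:\tau(I|_n)=\mathbf{0}\text{ for all sufficiently large }n\}$, and for $I\in\Theta_3^\tau$, $\tau^*(I)=\sum_{k=1}^\infty A^{k-1}\tau(I|_k)\in\mathbb{Z}^2$; $\tau^*(\Theta_3^\tau)=\{\tau^*(I):I\in\Theta_3^\tau\}$. *)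

theory Defs
  imports "HOL-Probability.Probability"
begin

definition Amat :: "int \<Rightarrow> int \<Rightarrow> real \<times> real \<Rightarrow> real \<times> real" where
  "Amat q1 q2 x = (3 * of_int q1 * fst x, 3 * of_int q2 * snd x)"

definition digits :: "(real \<times> real) set" where
  "digits = {(0,0), (1,0), (0,1)}"

definition mu_AD :: "int \<Rightarrow> int \<Rightarrow> (real \<times> real) measure" where
  "mu_AD q1 q2 = (THE \<mu>. sets \<mu> = sets borel \<and> prob_space \<mu> \<and>
      (\<forall>E \<in> sets borel. measure \<mu> E =
          (1/3) * (\<Sum>d\<in>digits. measure \<mu> ((\<lambda>x. Amat q1 q2 x - d) ` E))))"

definition expo :: "real \<times> real \<Rightarrow> real \<times> real \<Rightarrow> complex" where
  "expo l x = exp (- 2 * pi * \<i> * complex_of_real (l \<bullet> x))"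

definition orthogonal_set :: "(real \<times> real) measure \<Rightarrow> (real \<times> real) set \<Rightarrow> bool" where
  "orthogonal_set \<mu> \<Lambda> \<longleftrightarrow> countable \<Lambda> \<and>
     (\<forall>l\<in>\<Lambda>. \<forall>m\<in>\<Lambda>. l \<noteq> m \<longrightarrow>
        (\<integral>x. expo l x * cnj (expo m x) \<partial>\<mu>) = 0)"

definition maximal_orthogonal_set :: "(real \<times> real) measure \<Rightarrow> (real \<times> real) set \<Rightarrow> bool" where
  "maximal_orthogonal_set \<mu> \<Lambda> \<longleftrightarrow> orthogonal_set \<mu> \<Lambda> \<and>
     (\<forall>\<Lambda>'. orthogonal_set \<mu> \<Lambda>' \<and> \<Lambda> \<subseteq> \<Lambda>' \<longrightarrow> \<Lambda>' = \<Lambda>)"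

definition Gamma :: "int \<Rightarrow> int \<Rightarrow> (int \<times> int) set" where
  "Gamma q1 q2 = {(k, l). - 3 * q1 \<le> 2 * k \<and> 2 * k < 3 * q1 \<and> - 3 * q2 \<le> 2 * l \<and> 2 * l < 3 * q2}"

definition Eset :: "int \<Rightarrow> int \<Rightarrow> (int \<times> int) set" where
  "Eset q1 q2 = {a \<in> Gamma q1 q2. - q1 \<le> 2 * fst a \<and> 2 * fst a < q1}"

(* x \<equiv> y (mod A): x - y \<in> A Z^2 *)
definition congA :: "int \<Rightarrow> int \<Rightarrow> int \<times> int \<Rightarrow> int \<times> int \<Rightarrow> bool" where
  "congA q1 q2 x y \<longleftrightarrow> (3 * q1) dvd (fst x - fst y) \<and> (3 * q2) dvd (snd x - snd y)"

definition Theta3 :: "int set" where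
  "Theta3 = {-1, 0, 1}"

definition words :: "int list set" where
  "words = {I. I \<noteq> [] \<and> set I \<subseteq> Theta3}"

definition vq :: "int \<Rightarrow> int \<Rightarrow> int \<Rightarrow> int \<times> int" where
  "vq q1 q2 i = (i * q1, - (i * q2))"

definition maximal_tree_mapping :: "int \<Rightarrow> int \<Rightarrow> (int list \<Rightarrow> int \<times> int) \<Rightarrow> bool" where
  "maximal_tree_mapping q1 q2 \<tau> \<longleftrightarrow>
     (\<forall>I \<in> words. \<tau> I \<in> Gamma q1 q2) \<and>
     (\<forall>k::nat. \<forall>i \<in> Theta3. \<tau> (replicate k 0 @ [i]) = vq q1 q2 i) \<and>
     (\<forall>k::nat. \<forall>I. k \<ge> 1 \<longrightarrow> I \<in> words \<longrightarrow> length I = k \<longrightarrow> I \<noteq> replicate k 0 \<longrightarrow>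
        (\<exists>e \<in> Eset q1 q2. \<forall>j \<in> Theta3. congA q1 q2 (\<tau> (I @ [j])) (e + vq q1 q2 j))) \<and>
     (\<forall>I \<in> words. \<exists>J \<in> words. \<exists>N. \<forall>n\<ge>N. \<tau> (I @ J @ replicate n 0) = 0)"

definition prefix :: "(nat \<Rightarrow> int) \<Rightarrow> nat \<Rightarrow> int list" where
  "prefix I n = map I [0..<n]"

definition Theta_tau :: "(int list \<Rightarrow> int \<times> int) \<Rightarrow> (nat \<Rightarrow> int) set" where
  "Theta_tau \<tau> = {I. (\<forall>n. I n \<in> Theta3) \<and> (\<exists>N. \<forall>n\<ge>N. \<tau> (prefix I n) = 0)}"

definition of_int_pt :: "int \<times> int \<Rightarrow> real \<times> real" where
  "of_int_pt x = (of_int (fst x), of_int (snd x))"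

definition tau_star :: "int \<Rightarrow> int \<Rightarrow> (int list \<Rightarrow> int \<times> int) \<Rightarrow> (nat \<Rightarrow> int) \<Rightarrow> real \<times> real" where
  "tau_star q1 q2 \<tau> I = (\<Sum>k. (Amat q1 q2 ^^ k) (of_int_pt (\<tau> (prefix I (Suc k)))))"

end

theory Submission
  imports Defs
begin

text \<open>
  The Fourier transform of the measure is the product of the masks
  \<open>(1 + e(-x\<^sub>1) + e(-x\<^sub>2)) / 3\<close> evaluated at \<open>A\<^sup>-\<^sup>j \<xi>\<close>, \<open>j \<ge> 1\<close>, so it vanishes exactly on the union over
  \<open>n \<ge> 0\<close> of \<open>A\<^sup>n (\<plusminus>v + A \<int>\<^sup>2)\<close> with \<open>v = (q1, -q2)\<close>. Integer points have unique finite expansions in base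
  \<open>A\<close> with digits in \<open>Gamma\<close>, and each digit is \<open>e + j v\<close> modulo \<open>A\<close> for a unique class \<open>e \<in> Eset\<close> and a
  unique position \<open>j \<in> Theta3\<close>. Hence two integer points are orthogonal iff, at the first place where
  their digits differ, the two digits lie in the same class. An orthogonal set containing 0 is thus a set
  of digit sequences forming a tree in which all children of a node lie in one class. Maximality forces
  every node to have all three children, and recording the positions then labels the tree by words.
\<close>

section \<open>The self-affine measure\<close>

text \<open>Three unit complex numbers with sum zero form an equilateral triangle. As one of them is
  1, the others are the two primitive cube roots of unity; \<open>s\<close> says in which
  order.\<close>

lemma root3_sum_zero_iff:
  fixes a b :: real
  shows "1 + exp (- 2 * pi * \<i> * complex_of_real a) + exp (- 2 * pi * \<i> * complex_of_real b) = 0 \<longleftrightarrow>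
    (\<exists>s\<in>{-1, 1::int}. \<exists>(k::int) (l::int). a = s / 3 + k \<and> b = - (s / 3) + l)"
proof -
  have e: "exp (- 2 * pi * \<i> * complex_of_real t) = Complex (cos (2 * pi * t)) (- sin (2 * pi * t))" for t
    using cis_conv_exp[of "- (2 * pi * t)"] by (simp add: cis.ctr mult_ac)
  have shift: "cos (2 * pi * (t + of_int k)) = cos (2 * pi * t)" "sin (2 * pi * (t + of_int k)) = sin (2 * pi * t)"
    for t and k :: int
    using cos_add[of "2 * pi * t" "2 * pi * of_int k"] sin_add[of "2 * pi * t" "2 * pi * of_int k"]
    by (simp_all add: distrib_left)
  have third: "cos (2 * pi * (s / 3)) = -1/2" "sin (2 * pi * (s / 3)) = s * sqrt 3 / 2" if "s \<in> {-1, 1}" for s :: int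
    using that cos_120 sin_120 by auto
  have inv: "\<exists>s\<in>{-1, 1::int}. \<exists>k :: int. t = s / 3 + k" if "cos (2 * pi * t) = -1/2" for t
  proof -
    have "cos (2 * pi * t) = cos (2 * pi / 3)" using that cos_120 by simp
    then obtain n where n: "n \<in> \<int>" "2 * pi * t = 2 * pi / 3 + 2 * n * pi \<or> 2 * pi * t = - (2 * pi / 3) + 2 * n * pi"
      unfolding cos_eq by blast
    then obtain k :: int where k: "n = of_int k" using Ints_cases by metis
    from n(2) show ?thesis
    proof
      assume "2 * pi * t = 2 * pi / 3 + 2 * n * pi"
      then have "2 * pi * t = 2 * pi * (1 / 3 + n)" by (simp add: algebra_simps)
      then have "t = 1 / 3 + n" by (subst (asm) mult_cancel_left) simp
      then show ?thesis using k by (intro bexI[of _ 1] exI[of _ k]) auto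
    next
      assume "2 * pi * t = - (2 * pi / 3) + 2 * n * pi"
      then have "2 * pi * t = 2 * pi * (- 1 / 3 + n)" by (simp add: algebra_simps)
      then have "t = - 1 / 3 + n" by (subst (asm) mult_cancel_left) simp
      then show ?thesis using k by (intro bexI[of _ "-1"] exI[of _ k]) auto
    qed
  qed
  have "1 + exp (- 2 * pi * \<i> * complex_of_real a) + exp (- 2 * pi * \<i> * complex_of_real b) = 0 \<longleftrightarrow>
      cos (2 * pi * a) + cos (2 * pi * b) = -1 \<and> sin (2 * pi * a) = - sin (2 * pi * b)"
    unfolding e by (auto simp: complex_eq_iff)
  also have "\<dots> \<longleftrightarrow> (\<exists>s\<in>{-1, 1::int}. \<exists>(k::int) (l::int). a = s / 3 + k \<and> b = - (s / 3) + l)" (is "?L \<longleftrightarrow> ?R")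
  proof
    assume L: ?L
    then have "(sin (2 * pi * a))\<^sup>2 = (sin (2 * pi * b))\<^sup>2" by simp
    then have "(cos (2 * pi * a))\<^sup>2 = (cos (2 * pi * b))\<^sup>2" by (simp add: sin_squared_eq)
    \<comment> \<open>The other solution of the squared equation, opposite cosines, contradicts
      their sum being -1.\<close>
    then have "cos (2 * pi * a) = cos (2 * pi * b)" using L by (auto simp: power2_eq_iff)
    then have "cos (2 * pi * a) = -1/2" "cos (2 * pi * b) = -1/2" using L by auto
    then obtain s s' k l :: int where s: "s \<in> {-1, 1}" "a = s / 3 + k" "s' \<in> {-1, 1}" "b = s' / 3 + l"
      using inv by meson
    have "sin (2 * pi * a) = s * sqrt 3 / 2" "sin (2 * pi * b) = s' * sqrt 3 / 2"
      unfolding s(2,4) shift by (rule third; fact)+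
    then have "s' = - s" using L s(1,3) by auto
    then show ?R using s by (intro bexI[OF _ s(1)] exI[of _ k] exI[of _ l]) auto
  next
    assume ?R
    then obtain s k l :: int where s: "s \<in> {-1, 1}" "a = s / 3 + k" "b = - (s / 3) + l" by blast
    from s(3) have s3: "b = of_int (- s) / 3 + l" by simp
    have "cos (2 * pi * a) = -1/2" "sin (2 * pi * a) = s * sqrt 3 / 2"
      unfolding s(2) shift by (rule third; fact)+
    moreover have "cos (2 * pi * b) = -1/2" "sin (2 * pi * b) = of_int (- s) * sqrt 3 / 2"
      unfolding s3 shift using s(1) by (subst third; auto)+
    ultimately show ?L by simp
  qed
  finally show ?thesis .
qed

section \<open>Averages over a uniform digit\<close>

lemma card_digits: "card digits = 3"
  by (simp add: digits_def)

lemma finite_digits [simp]: "finite digits" and digits_ne [simp]: "digits \<noteq> {}"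
  by (simp_all add: digits_def)

lemma integral_digits:
  fixes f :: "real \<times> real \<Rightarrow> 'b::{banach, second_countable_topology}"
  shows "(\<integral>d. f d \<partial>measure_pmf (pmf_of_set digits)) = (1/3) *\<^sub>R (\<Sum>d\<in>digits. f d)"
  by (subst integral_measure_pmf[of digits])
     (auto simp: card_digits scaleR_sum_right)

lemma (in prob_space) integral_digits_pair:
  fixes f :: "(real \<times> real) \<times> 'a \<Rightarrow> 'b::{banach, second_countable_topology}"
  assumes [measurable]: "f \<in> borel_measurable (measure_pmf (pmf_of_set digits) \<Otimes>\<^sub>M M)"
    and B: "\<And>x. norm (f x) \<le> B"
  shows "(\<integral>x. f x \<partial>(measure_pmf (pmf_of_set digits) \<Otimes>\<^sub>M M)) = (1/3) *\<^sub>R (\<Sum>d\<in>digits. \<integral>x. f (d, x) \<partial>M)"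
proof -
  interpret P: pair_prob_space "measure_pmf (pmf_of_set digits)" M ..
  have "integrable (measure_pmf (pmf_of_set digits) \<Otimes>\<^sub>M M) f"
    by (rule P.integrable_const_bound[of _ B]) (auto simp: B)
  from P.integral_fst'[OF this] show ?thesis by (simp add: integral_digits)
qed

text \<open>Closed sets form a generating pi-system, and their indicators are limits of Lipschitz
  functions of the distance. Lipschitz test functions are chosen because composition with a
  contraction shrinks their constant.\<close>

lemma measure_eqI_Lipschitz:
  fixes \<mu> \<nu> :: "'a::metric_space measure"
  assumes \<mu>: "sets \<mu> = sets borel" "prob_space \<mu>" and \<nu>: "sets \<nu> = sets borel" "prob_space \<nu>"
    and eq: "\<And>f L. (\<And>x y. \<bar>f x - f y\<bar> \<le> L * dist x y) \<Longrightarrow> (\<And>x. \<bar>f x\<bar> \<le> (1::real)) \<Longrightarrow> L \<ge> 0 \<Longrightarrow>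
      (\<integral>x. f x \<partial>\<mu>) = (\<integral>x. f x \<partial>\<nu>)"
  shows "\<mu> = \<nu>"
proof (rule measure_eqI_generator_eq[where \<Omega> = UNIV and E = "Collect closed" and A = "\<lambda>_. UNIV"])
  interpret \<mu>: prob_space \<mu> by fact
  interpret \<nu>: prob_space \<nu> by fact
  show "Int_stable (Collect closed :: 'a set set)" by (auto simp: Int_stable_def)
  show "sets \<mu> = sigma_sets UNIV (Collect closed)" "sets \<nu> = sigma_sets UNIV (Collect closed)"
    unfolding \<mu> \<nu> by (subst borel_eq_closed, simp)+
  show "emeasure \<mu> F = emeasure \<nu> F" if "F \<in> Collect closed" for F
  \<comment> \<open>\<open>infdist\<close> to the empty set is 0, so the approximants below would
    tend to 1 instead of to the indicator.\<close>
  proof (cases "F = {}")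
    case False
    from that have F: "closed F" by simp
    define f where "f n x = max 0 (1 - real n * infdist x F)" for n x
    have lip: "\<bar>f n x - f n y\<bar> \<le> real n * dist x y" for n x y
    proof -
      have "\<bar>f n x - f n y\<bar> \<le> \<bar>real n * infdist x F - real n * infdist y F\<bar>" unfolding f_def by linarith
      also have "\<dots> = real n * \<bar>infdist x F - infdist y F\<bar>" by (simp add: abs_mult flip: right_diff_distrib)
      also have "\<dots> \<le> real n * dist x y" by (intro mult_left_mono infdist_triangle_abs) auto
      finally show ?thesis .
    qed
    have bd: "\<bar>f n x\<bar> \<le> 1" for n x by (auto simp: f_def infdist_nonneg)
    have f_meas: "f n \<in> borel_measurable borel" for n
      unfolding f_def by (intro borel_measurable_continuous_onI continuous_intros)
    have ptw: "(\<lambda>n. f n x) \<longlonglongrightarrow> indicator F x" for x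
    proof (cases "x \<in> F")
      case True
      then show ?thesis by (simp add: f_def)
    next
      case xF: False
      then have pos: "infdist x F > 0" using F False by (simp add: infdist_pos_not_in_closed)
      obtain N where N: "1 / infdist x F < real N" using reals_Archimedean2 by blast
      have "f n x = 0" if "n \<ge> N" for n
      proof -
        have "1 / infdist x F < real n" using N that by linarith
        then have "1 < real n * infdist x F" using pos by (simp add: field_simps)
        then show ?thesis by (simp add: f_def)
      qed
      then have "eventually (\<lambda>n. f n x = 0) sequentially" by (auto simp: eventually_sequentially)
      then show ?thesis using xF by (simp add: tendsto_eventually)
    qed
    have lim: "(\<lambda>n. \<integral>x. f n x \<partial>\<rho>) \<longlonglongrightarrow> measure \<rho> F" if s: "sets \<rho> = sets borel" and pr: "prob_space \<rho>" for \<rho>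
    proof -
      interpret prob_space \<rho> by fact
      have [measurable]: "f n \<in> borel_measurable \<rho>" for n
        using f_meas s by (simp cong: measurable_cong_sets)
      have F': "F \<in> sets \<rho>" using F s by auto
      then have "(\<lambda>n. \<integral>x. f n x \<partial>\<rho>) \<longlonglongrightarrow> (\<integral>x. indicator F x \<partial>\<rho>)"
        by (intro integral_dominated_convergence[where w = "\<lambda>_. 1"]) (auto simp: ptw bd)
      then show ?thesis using F' by simp
    qed
    have "(\<lambda>n. \<integral>x. f n x \<partial>\<mu>) = (\<lambda>n. \<integral>x. f n x \<partial>\<nu>)"
      by (rule ext, rule eq[OF lip bd]) simp
    then have "measure \<mu> F = measure \<nu> F"
      using lim[OF \<mu>] lim[OF \<nu>] by (metis LIMSEQ_unique)
    then show ?thesis by (simp add: \<mu>.emeasure_eq_measure \<nu>.emeasure_eq_measure)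
  qed simp
qed (auto simp: prob_space.finite_measure[OF \<mu>(2)] finite_measure.emeasure_finite)

section \<open>Existence and uniqueness of the invariant measure\<close>

locale sierpinski =
  fixes q1 q2 :: int
  assumes q1: "1 \<le> q1" and q2: "1 \<le> q2"
begin

text \<open>The inverse \<open>A^-1 (x + d)\<close> of \<open>x -> A x - d\<close>. As
  \<open>A\<close> is diagonal, hence self-adjoint, \<open>contr 0\<close> also rescales the
  frequencies of the Fourier transform.\<close>

definition contr :: "real \<times> real \<Rightarrow> real \<times> real \<Rightarrow> real \<times> real" where
  "contr d x = ((fst x + fst d) / (3 * q1), (snd x + snd d) / (3 * q2))"

text \<open>The predicate under \<open>THE\<close> in \<open>mu_AD_def\<close>, worded so that it
  can be folded there.\<close>

definition invariant :: "(real \<times> real) measure \<Rightarrow> bool" where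
  "invariant \<mu> \<longleftrightarrow> sets \<mu> = sets borel \<and> prob_space \<mu> \<and>
      (\<forall>E \<in> sets borel. measure \<mu> E =
          (1/3) * (\<Sum>d\<in>digits. measure \<mu> ((\<lambda>x. Amat q1 q2 x - d) ` E)))"

lemma expanding_image: "(\<lambda>x. Amat q1 q2 x - d) ` E = contr d -` E"
proof -
  have l: "contr d (Amat q1 q2 x - d) = x" and r: "Amat q1 q2 (contr d x) - d = x" for x
    using q1 q2 by (auto simp: contr_def Amat_def prod_eq_iff)
  show ?thesis
  proof (intro set_eqI iffI)
    fix y assume "y \<in> contr d -` E"
    then show "y \<in> (\<lambda>x. Amat q1 q2 x - d) ` E" by (intro image_eqI[of _ _ "contr d y"]) (simp_all add: r)
  qed (auto simp: l)
qed

lemma continuous_contr: "continuous_on UNIV (contr d)"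
  unfolding contr_def using q1 q2 by (intro continuous_intros) auto

lemma measurable_contr [measurable]: "contr d \<in> borel \<rightarrow>\<^sub>M borel"
  by (intro borel_measurable_continuous_onI continuous_contr)

lemma dist_contr: "dist (contr d x) (contr d y) \<le> dist x y / 3"
proof -
  have *: "\<bar>a / (3 * of_int q) - b / (3 * of_int q)\<bar> \<le> \<bar>a - b\<bar> / 3" if "q \<ge> 1" for a b :: real and q :: int
  proof -
    have "\<bar>a / (3 * of_int q) - b / (3 * of_int q)\<bar> = \<bar>a - b\<bar> / (3 * of_int q)"
      using that by (simp add: abs_divide flip: diff_divide_distrib)
    also have "\<dots> \<le> \<bar>a - b\<bar> / 3" using that by (intro divide_left_mono) auto
    finally show ?thesis .
  qed
  have "dist (contr d x) (contr d y) \<le> sqrt ((\<bar>fst x - fst y\<bar> / 3)\<^sup>2 + (\<bar>snd x - snd y\<bar> / 3)\<^sup>2)"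
    unfolding dist_prod_def contr_def dist_real_def
    using *[OF q1, of "fst x + fst d" "fst y + fst d"] *[OF q2, of "snd x + snd d" "snd y + snd d"]
    by (intro real_sqrt_le_mono add_mono power_mono) auto
  also have "\<dots> = sqrt (((fst x - fst y)\<^sup>2 + (snd x - snd y)\<^sup>2) / 9)"
    by (simp add: power_divide add_divide_distrib)
  also have "\<dots> = dist x y / 3"
    unfolding dist_prod_def dist_real_def by (simp add: real_sqrt_divide)
  finally show ?thesis .
qed

text \<open>Invariance says that \<open>\<mu>\<close> is the law of \<open>contr d x\<close> for a
  uniform digit \<open>d\<close> and an independent point \<open>x\<close> of law
  \<open>\<mu>\<close>. Once these two measures agree, change of variables and Fubini give the
  formula for every bounded \<open>f\<close>.\<close>

lemma integral_invariant:
  fixes f :: "real \<times> real \<Rightarrow> 'b::{banach, second_countable_topology}"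
  assumes inv: "invariant \<mu>" and f [measurable]: "f \<in> borel_measurable borel" and B: "\<And>x. norm (f x) \<le> B"
  shows "(\<integral>x. f x \<partial>\<mu>) = (1/3) *\<^sub>R (\<Sum>d\<in>digits. \<integral>x. f (contr d x) \<partial>\<mu>)"
proof -
  interpret prob_space \<mu> using inv by (simp add: invariant_def)
  have s [measurable_cong]: "sets \<mu> = sets borel" using inv by (simp add: invariant_def)
  let ?Q = "measure_pmf (pmf_of_set digits) \<Otimes>\<^sub>M \<mu>"
  let ?c = "\<lambda>(d, x). contr d x"
  have [measurable]: "?c \<in> ?Q \<rightarrow>\<^sub>M borel"
  proof -
    have [measurable]: "(\<lambda>p. g (fst p)) \<in> ?Q \<rightarrow>\<^sub>M borel" for g :: "_ \<Rightarrow> real"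
      by (rule measurable_compose[OF measurable_fst]) auto
    have [measurable]: "(\<lambda>p. g (snd p)) \<in> ?Q \<rightarrow>\<^sub>M borel" if "g \<in> borel_measurable borel" for g :: "_ \<Rightarrow> real"
      by (rule measurable_compose[OF measurable_snd]) (use that in measurable)
    have [measurable]: "fst \<in> borel_measurable (borel :: (real \<times> real) measure)" "snd \<in> borel_measurable (borel :: (real \<times> real) measure)"
      by (auto intro!: borel_measurable_continuous_onI continuous_intros)
    show ?thesis unfolding contr_def split_beta by measurable
  qed
  interpret Q: pair_prob_space "measure_pmf (pmf_of_set digits)" \<mu> ..
  have "\<mu> = distr ?Q borel ?c"
  proof (rule measure_eqI)
    fix E assume "E \<in> sets \<mu>"
    then have E [measurable]: "E \<in> sets borel" by (simp add: s)
    interpret D: prob_space "distr ?Q borel ?c" by (rule Q.prob_space_distr) measurable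
    have preimage: "(\<integral>x. indicator E (contr d x) \<partial>\<mu>) = measure \<mu> (contr d -` E)" for d
    proof -
      have "contr d -` E \<in> sets \<mu>"
        using measurable_sets[OF measurable_contr E, of d] by (simp add: s)
      then have "(\<integral>x. indicator (contr d -` E) x \<partial>\<mu>) = measure \<mu> (contr d -` E)" by simp
      then show ?thesis by (simp add: indicator_def vimage_def)
    qed
    have "measure (distr ?Q borel ?c) E = (\<integral>x. indicator E x \<partial>distr ?Q borel ?c)" by simp
    also have "\<dots> = (\<integral>x. indicator E (?c x) \<partial>?Q)" by (rule integral_distr) measurable
    also have "\<dots> = (1/3) *\<^sub>R (\<Sum>d\<in>digits. \<integral>x. indicator E (contr d x) \<partial>\<mu>)"
      by (subst integral_digits_pair[of _ 1]) auto
    also have "\<dots> = measure \<mu> E"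
      using inv E by (simp add: preimage invariant_def expanding_image)
    finally show "emeasure \<mu> E = emeasure (distr ?Q borel ?c) E"
      by (simp add: emeasure_eq_measure D.emeasure_eq_measure)
  qed (simp add: s)
  then have "(\<integral>x. f x \<partial>\<mu>) = (\<integral>x. f x \<partial>distr ?Q borel ?c)" by simp
  also have "\<dots> = (\<integral>x. f (?c x) \<partial>?Q)" by (rule integral_distr) measurable
  also have "\<dots> = (1/3) *\<^sub>R (\<Sum>d\<in>digits. \<integral>x. f (contr d x) \<partial>\<mu>)"
    by (subst integral_digits_pair[of _ B]) (auto simp: B)
  finally show ?thesis .
qed

text \<open>Iterating the invariance \<open>n\<close> times divides the Lipschitz constant of the test function by \<open>3\<^sup>n\<close>. As no moments
  of an invariant measure are known in advance, the deviation is measured with a truncated norm.\<close>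

lemma invariant_unique:
  assumes \<mu>: "invariant \<mu>" and \<nu>: "invariant \<nu>"
  shows "\<mu> = \<nu>"
proof (rule measure_eqI_Lipschitz)
  show "sets \<mu> = sets borel" "prob_space \<mu>" "sets \<nu> = sets borel" "prob_space \<nu>"
    using \<mu> \<nu> by (auto simp: invariant_def)
  fix f :: "real \<times> real \<Rightarrow> real" and L
  assume fL: "\<And>x y. \<bar>f x - f y\<bar> \<le> L * dist x y" and f1: "\<And>x. \<bar>f x\<bar> \<le> 1" and L0: "L \<ge> 0"
  \<comment> \<open>The cap 2 bounds \<open>|g x - g 0|\<close> whenever \<open>|g| <= 1\<close>,
    and it supplies the dominating function for the limit.\<close>
  define h where "h \<rho> K = (\<integral>x. min 2 (K * norm x) \<partial>\<rho>)" for \<rho> :: "(real \<times> real) measure" and K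
  have cont: "continuous_on UNIV g" if "\<And>x y. \<bar>g x - g y\<bar> \<le> K * dist x y" "K \<ge> 0" for g :: "real \<times> real \<Rightarrow> real" and K
    by (rule lipschitz_on_continuous_on[of K]) (use that in \<open>auto simp: lipschitz_on_def dist_real_def\<close>)
  have near: "\<bar>(\<integral>x. g x \<partial>\<rho>) - g 0\<bar> \<le> h \<rho> K"
    if \<rho>: "invariant \<rho>" and g: "\<And>x y. \<bar>g x - g y\<bar> \<le> K * dist x y" "\<And>x. \<bar>g x\<bar> \<le> 1" "K \<ge> 0" for g K \<rho>
  proof -
    interpret prob_space \<rho> using \<rho> by (simp add: invariant_def)
    have s [measurable_cong]: "sets \<rho> = sets borel" using \<rho> by (simp add: invariant_def)
    have [measurable]: "g \<in> borel_measurable borel" using cont[OF g(1,3)] by (rule borel_measurable_continuous_onI)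
    have ig: "integrable \<rho> g" by (rule integrable_const_bound[of _ 1]) (use g in auto)
    have ih: "integrable \<rho> (\<lambda>x. min 2 (K * norm x))"
      by (rule integrable_const_bound[of _ 2]) (use g in \<open>auto simp: min_def\<close>)
    have "(\<integral>x. g x \<partial>\<rho>) - g 0 = (\<integral>x. g x - g 0 \<partial>\<rho>)" using ig by (simp add: prob_space)
    also have "\<bar>\<dots>\<bar> \<le> (\<integral>x. min 2 (K * norm x) \<partial>\<rho>)"
    proof -
      have "\<bar>\<integral>x. g x - g 0 \<partial>\<rho>\<bar> \<le> (\<integral>x. \<bar>g x - g 0\<bar> \<partial>\<rho>)" by (rule integral_abs_bound)
      also have "\<dots> \<le> (\<integral>x. min 2 (K * norm x) \<partial>\<rho>)"
      proof (rule integral_mono)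
        show "integrable \<rho> (\<lambda>x. \<bar>g x - g 0\<bar>)" using ig by auto
        show "\<bar>g x - g 0\<bar> \<le> min 2 (K * norm x)" for x
          using g(1)[of x 0] g(2)[of x] g(2)[of 0] by (auto simp: abs_le_iff)
      qed (rule ih)
      finally show ?thesis .
    qed
    finally show ?thesis by (simp add: h_def)
  qed
  \<comment> \<open>Both \<open>g\<close> and \<open>K\<close> vary in the induction: one use of
    invariance replaces \<open>g\<close> by its composition with \<open>contr d\<close>, and
    \<open>K\<close> by \<open>K / 3\<close>.\<close>
  have step: "\<bar>(\<integral>x. g x \<partial>\<mu>) - (\<integral>x. g x \<partial>\<nu>)\<bar> \<le> h \<mu> (K / 3 ^ n) + h \<nu> (K / 3 ^ n)"
    if g: "\<And>x y. \<bar>g x - g y\<bar> \<le> K * dist x y" "\<And>x. \<bar>g x\<bar> \<le> 1" "K \<ge> 0" for g K n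
    using g
  proof (induction n arbitrary: g K)
    case 0
    show ?case using near[OF \<mu>, of g K] near[OF \<nu>, of g K] 0 by (auto simp: abs_le_iff)
  next
    case (Suc n)
    have [measurable]: "g \<in> borel_measurable borel"
      using cont[OF Suc.prems(1,3)] by (rule borel_measurable_continuous_onI)
    have b: "norm (g x) \<le> 1" for x using Suc.prems(2) by simp
    let ?D = "\<lambda>g. (\<integral>x. g x \<partial>\<mu>) - (\<integral>x. g x \<partial>\<nu>)"
    let ?b = "h \<mu> (K / 3 ^ Suc n) + h \<nu> (K / 3 ^ Suc n)"
    have "?D g = (1/3) * (\<Sum>d\<in>digits. ?D (\<lambda>x. g (contr d x)))"
      unfolding integral_invariant[OF \<mu> \<open>g \<in> _\<close> b] integral_invariant[OF \<nu> \<open>g \<in> _\<close> b]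
      by (simp add: sum_subtractf right_diff_distrib)
    also have "\<bar>\<dots>\<bar> \<le> (1/3) * (\<Sum>d\<in>digits. \<bar>?D (\<lambda>x. g (contr d x))\<bar>)"
      by (simp add: abs_mult sum_abs)
    also have "\<dots> \<le> (1/3) * (\<Sum>d\<in>digits. ?b)"
    proof (intro mult_left_mono sum_mono)
      fix d
      have "\<bar>g (contr d x) - g (contr d y)\<bar> \<le> K / 3 * dist x y" for x y
      proof -
        have "\<bar>g (contr d x) - g (contr d y)\<bar> \<le> K * dist (contr d x) (contr d y)" by (rule Suc.prems)
        also have "\<dots> \<le> K * (dist x y / 3)" by (intro mult_left_mono dist_contr Suc.prems)
        finally show ?thesis by simp
      qed
      from Suc.IH[of "\<lambda>x. g (contr d x)" "K / 3", OF this] Suc.prems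
      show "\<bar>?D (\<lambda>x. g (contr d x))\<bar> \<le> ?b" by simp
    qed simp
    also have "\<dots> = ?b" by (simp add: card_digits)
    finally show ?case .
  qed
  have hlim: "(\<lambda>n. h \<rho> (L / 3 ^ n)) \<longlonglongrightarrow> 0" if \<rho>: "invariant \<rho>" for \<rho>
  proof -
    interpret prob_space \<rho> using \<rho> by (simp add: invariant_def)
    have s [measurable_cong]: "sets \<rho> = sets borel" using \<rho> by (simp add: invariant_def)
    have "(\<lambda>n. \<integral>x. min 2 (L / 3 ^ n * norm x) \<partial>\<rho>) \<longlonglongrightarrow> (\<integral>x. 0 \<partial>\<rho>)"
    proof (rule integral_dominated_convergence[where w = "\<lambda>_. 2"])
      show "AE x in \<rho>. (\<lambda>n. min 2 (L / 3 ^ n * norm x)) \<longlonglongrightarrow> 0"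
      proof (rule AE_I2)
        fix x
        have "(\<lambda>n. min 2 (L * norm x * (1 / 3) ^ n)) \<longlonglongrightarrow> min 2 (L * norm x * 0)"
          by (intro tendsto_intros LIMSEQ_realpow_zero) auto
        then show "(\<lambda>n. min 2 (L / 3 ^ n * norm x)) \<longlonglongrightarrow> 0" by (simp add: power_divide mult_ac)
      qed
    qed (use L0 in \<open>auto simp: min_def\<close>)
    then show ?thesis by (simp add: h_def)
  qed
  have "(\<lambda>n. h \<mu> (L / 3 ^ n) + h \<nu> (L / 3 ^ n)) \<longlonglongrightarrow> 0"
    using tendsto_add[OF hlim[OF \<mu>] hlim[OF \<nu>]] by simp
  then have "\<bar>(\<integral>x. f x \<partial>\<mu>) - (\<integral>x. f x \<partial>\<nu>)\<bar> \<le> 0"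
    by (rule LIMSEQ_le_const) (use step[OF fL f1 L0] in auto)
  then show "(\<integral>x. f x \<partial>\<mu>) = (\<integral>x. f x \<partial>\<nu>)" by simp
qed

text \<open>The law of the random sum of \<open>A\<^sup>-\<^sup>n d\<^sub>n\<close>, \<open>n \<ge> 1\<close>, for independent uniform digits \<open>d\<^sub>n\<close>. The indicators \<open>a\<close> and \<open>b\<close> give the
  coordinates of a digit and keep the series summable on the whole stream space.\<close>

lemma invariant_exists: "\<exists>\<mu>. invariant \<mu>"
proof -
  let ?P = "measure_pmf (pmf_of_set digits)"
  let ?S = "stream_space ?P"
  interpret S: prob_space ?S by (rule prob_space.prob_space_stream_space[OF prob_space_measure_pmf])
  define a :: "real \<times> real \<Rightarrow> real" where "a = indicator {(1,0)}"
  define b :: "real \<times> real \<Rightarrow> real" where "b = indicator {(0,1)}"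
  define X :: "(real \<times> real) stream \<Rightarrow> real \<times> real" where
    "X s = (\<Sum>n. a (s !! n) / (3 * real_of_int q1) ^ Suc n, \<Sum>n. b (s !! n) / (3 * real_of_int q2) ^ Suc n)" for s
  have ab: "a d = fst d" "b d = snd d" if "d \<in> digits" for d
    using that by (auto simp: a_def b_def digits_def)
  have summ: "summable (\<lambda>n. indicator D (s !! n) / (3 * real_of_int q) ^ Suc n)" if q: "q \<ge> 1" for s :: "(real \<times> real) stream" and q D
  proof (rule summable_comparison_test[OF _ summable_geometric[of "1/3"]])
    show "\<exists>N. \<forall>n\<ge>N. norm (indicator D (s !! n) / (3 * real_of_int q) ^ Suc n) \<le> (1 / 3) ^ n"
    proof (intro exI allI impI)
      fix n
      have "norm (indicator D (s !! n) / (3 * real_of_int q) ^ Suc n) \<le> 1 / (3 * real_of_int q) ^ Suc n"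
        using q by (auto simp: norm_divide indicator_def)
      also have "\<dots> \<le> 1 / 3 ^ n"
      proof -
        have "(3::real) ^ n \<le> 3 ^ Suc n" by simp
        also have "\<dots> \<le> (3 * real_of_int q) ^ Suc n" using q by (intro power_mono) auto
        finally show ?thesis by (intro divide_left_mono) (use q in auto)
      qed
      finally show "norm (indicator D (s !! n) / (3 * real_of_int q) ^ Suc n) \<le> (1 / 3) ^ n" by (simp add: power_divide)
    qed
  qed simp
  have suma: "summable (\<lambda>n. a (s !! n) / (3 * real_of_int q1) ^ Suc n)" "summable (\<lambda>n. b (s !! n) / (3 * real_of_int q2) ^ Suc n)" for s
    using summ[OF q1] summ[OF q2] by (auto simp: a_def b_def)
  \<comment> \<open>Prepending \<open>d\<close> shifts both series by one place; the hypothesis on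
    \<open>d\<close> turns \<open>a d\<close> and \<open>b d\<close> into its coordinates.\<close>
  have Xcons: "X (d ## s) = contr d (X s)" if "d \<in> digits" for d s
  proof -
    have h: "(\<Sum>n. g ((d ## s) !! n) / r ^ Suc n) = ((\<Sum>n. g (s !! n) / r ^ Suc n) + g d) / r"
      if "summable (\<lambda>n. g ((d ## s) !! n) / r ^ Suc n)" "summable (\<lambda>n. g (s !! n) / r ^ Suc n)" for g :: "real \<times> real \<Rightarrow> real" and r
    proof -
      have "(\<Sum>n. g ((d ## s) !! n) / r ^ Suc n) = (\<Sum>n. g ((d ## s) !! Suc n) / r ^ Suc (Suc n)) + g ((d ## s) !! 0) / r ^ Suc 0"
        using suminf_split_head[OF that(1)] by linarith
      also have "(\<Sum>n. g ((d ## s) !! Suc n) / r ^ Suc (Suc n)) = (\<Sum>n. (g (s !! n) / r ^ Suc n) / r)"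
        by (simp add: mult_ac)
      also have "\<dots> = (\<Sum>n. g (s !! n) / r ^ Suc n) / r" by (rule suminf_divide[OF that(2)])
      finally show ?thesis by (simp add: add_divide_distrib)
    qed
    show ?thesis unfolding X_def contr_def
      by (simp only: h[OF suma(1) suma(1)] h[OF suma(2) suma(2)] fst_conv snd_conv ab[OF that] of_int_mult of_int_numeral)
  qed
  have [measurable]: "X \<in> ?S \<rightarrow>\<^sub>M borel"
  proof -
    have [measurable]: "(\<lambda>s. g (s !! n)) \<in> ?S \<rightarrow>\<^sub>M borel" for g :: "_ \<Rightarrow> real" and n
      by (rule measurable_compose[OF measurable_snth]) auto
    show ?thesis unfolding X_def by measurable
  qed
  have "invariant (distr ?S borel X)"
    unfolding invariant_def
  proof (intro conjI ballI)
    show "prob_space (distr ?S borel X)" by (rule S.prob_space_distr) measurable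
    fix E :: "(real \<times> real) set" assume E [measurable]: "E \<in> sets borel"
    have "measure (distr ?S borel X) E = measure ?S {s \<in> space ?S. X s \<in> E}"
      by (subst measure_distr) (auto simp: vimage_def Int_def conj_commute)
    \<comment> \<open>A stream splits into its first digit and an independent tail of the same
      law.\<close>
    also have "\<dots> = (\<integral>d. measure ?S {s \<in> space ?S. X (d ## s) \<in> E} \<partial>?P)"
    proof -
      have "ennreal (measure ?S {s \<in> space ?S. X s \<in> E}) =
          (\<integral>\<^sup>+d. ennreal (measure ?S {s \<in> space ?S. X (d ## s) \<in> E}) \<partial>?P)"
        by (rule prob_space.prob_stream_space[OF prob_space_measure_pmf]) measurable
      also have "\<dots> = ennreal (\<integral>d. measure ?S {s \<in> space ?S. X (d ## s) \<in> E} \<partial>?P)"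
        by (rule nn_integral_eq_integral, rule measure_pmf.integrable_const_bound[of _ 1]) auto
      finally show ?thesis by simp
    qed
    also have "\<dots> = (1/3) * (\<Sum>d\<in>digits. measure ?S {s \<in> space ?S. X (d ## s) \<in> E})"
      by (simp add: integral_digits)
    also have "\<dots> = (1/3) * (\<Sum>d\<in>digits. measure (distr ?S borel X) ((\<lambda>x. Amat q1 q2 x - d) ` E))"
    proof -
      have "measure ?S {s \<in> space ?S. X (d ## s) \<in> E} = measure (distr ?S borel X) ((\<lambda>x. Amat q1 q2 x - d) ` E)"
        if "d \<in> digits" for d
      proof -
        have [measurable]: "contr d -` E \<in> sets borel" using measurable_sets[OF measurable_contr E, of d] by simp
        show ?thesis unfolding expanding_image
          by (subst measure_distr) (auto simp: Xcons[OF that] vimage_def Int_def conj_commute)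
      qed
      then show ?thesis by simp
    qed
    finally show "measure (distr ?S borel X) E = (1/3) * (\<Sum>d\<in>digits. measure (distr ?S borel X) ((\<lambda>x. Amat q1 q2 x - d) ` E))" .
  qed simp
  then show ?thesis ..
qed

text \<open>Existence and uniqueness make the description operator denote; everything later uses
  \<open>mu_AD\<close> only through this fact.\<close>

lemma invariant_mu_AD: "invariant (mu_AD q1 q2)"
proof -
  have "\<exists>!\<mu>. invariant \<mu>" using invariant_exists invariant_unique by blast
  then show ?thesis unfolding mu_AD_def invariant_def[symmetric] by (rule theI')
qed

section \<open>Zeros of the Fourier transform\<close>

definition zero_diff :: "int \<times> int \<Rightarrow> bool" where
  "zero_diff w \<longleftrightarrow> (\<exists>n. \<exists>s\<in>{-1, 1}. \<exists>k l.
     w = ((3 * q1) ^ n * (s * q1 + 3 * q1 * k), (3 * q2) ^ n * (- (s * q2) + 3 * q2 * l)))"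

text \<open>The Fourier transform of the uniform distribution on \<open>digits\<close>.\<close>

definition mask :: "real \<times> real \<Rightarrow> complex" where
  "mask \<eta> = (1 + exp (- 2 * pi * \<i> * complex_of_real (fst \<eta>)) + exp (- 2 * pi * \<i> * complex_of_real (snd \<eta>))) / 3"

definition ft :: "real \<times> real \<Rightarrow> complex" where
  "ft \<xi> = (\<integral>x. expo \<xi> x \<partial>mu_AD q1 q2)"

lemma norm_expo [simp]: "norm (expo l x) = 1"
  by (simp add: expo_def norm_exp_eq_Re)

lemma continuous_expo: "continuous_on UNIV (expo l)"
  unfolding expo_def by (intro continuous_intros)

lemma measurable_expo [measurable]: "expo l \<in> borel_measurable borel"
  by (intro borel_measurable_continuous_onI continuous_expo)

lemma expo_mult_cnj: "expo l x * cnj (expo m x) = expo (l - m) x"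
  by (simp add: expo_def exp_cnj inner_diff_left flip: exp_add) (simp add: algebra_simps)

lemma expo_contr: "expo \<xi> (contr d x) = expo (contr 0 \<xi>) d * expo (contr 0 \<xi>) x"
proof -
  have "\<xi> \<bullet> contr d x = contr 0 \<xi> \<bullet> d + contr 0 \<xi> \<bullet> x"
    by (simp add: contr_def inner_prod_def add_divide_distrib algebra_simps)
  then show ?thesis by (simp add: expo_def distrib_left flip: exp_add)
qed

lemma prob_space_mu_AD: "prob_space (mu_AD q1 q2)" and sets_mu_AD [measurable_cong]: "sets (mu_AD q1 q2) = sets borel"
  using invariant_mu_AD by (auto simp: invariant_def)

text \<open>By invariance the character splits off one factor for each digit; the average of these
  factors is the mask.\<close>

lemma ft_contr: "ft \<xi> = mask (contr 0 \<xi>) * ft (contr 0 \<xi>)"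
proof -
  have "ft \<xi> = (1/3) *\<^sub>R (\<Sum>d\<in>digits. expo (contr 0 \<xi>) d * ft (contr 0 \<xi>))"
    unfolding ft_def by (subst integral_invariant[OF invariant_mu_AD, of _ 1]) (auto simp: expo_contr)
  also have "\<dots> = mask (contr 0 \<xi>) * ft (contr 0 \<xi>)"
    by (simp add: digits_def mask_def expo_def inner_prod_def scaleR_conv_of_real algebra_simps)
  finally show ?thesis .
qed

lemma contr_0_funpow: "(contr 0 ^^ n) \<xi> = (fst \<xi> / (3 * real_of_int q1) ^ n, snd \<xi> / (3 * real_of_int q2) ^ n)"
  by (induction n) (auto simp: contr_def mult_ac)

text \<open>The rescaled frequencies tend to 0, where the transform is the total mass 1. This keeps
  the infinite product of masks from vanishing without a zero factor.\<close>

lemma ft_zoom_lim: "(\<lambda>n. ft ((contr 0 ^^ n) \<xi>)) \<longlonglongrightarrow> 1"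
proof -
  interpret prob_space "mu_AD q1 q2" by (rule prob_space_mu_AD)
  have z: "(\<lambda>n. a / (3 * real_of_int q) ^ n) \<longlonglongrightarrow> 0" if "q \<ge> 1" for a :: real and q
  proof -
    have "(\<lambda>n. a * (1 / (3 * real_of_int q)) ^ n) \<longlonglongrightarrow> a * 0"
      using that by (intro tendsto_intros LIMSEQ_realpow_zero) auto
    then show ?thesis by (simp add: power_divide)
  qed
  have "(\<lambda>n. expo ((contr 0 ^^ n) \<xi>) x) \<longlonglongrightarrow> expo 0 x" for x
  proof -
    have "(\<lambda>n. (contr 0 ^^ n) \<xi>) \<longlonglongrightarrow> (0, 0)"
      unfolding contr_0_funpow by (intro tendsto_Pair z q1 q2)
    then show ?thesis unfolding expo_def zero_prod_def by (intro tendsto_intros)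
  qed
  then have "(\<lambda>n. ft ((contr 0 ^^ n) \<xi>)) \<longlonglongrightarrow> (\<integral>x. 1 \<partial>mu_AD q1 q2)"
    unfolding ft_def by (intro integral_dominated_convergence[where w = "\<lambda>_. 1"]) (auto simp: expo_def[of 0])
  then show ?thesis by (simp add: prob_space)
qed

text \<open>No infinite product is formed. If no mask vanishes, a zero of \<open>ft\<close> is
  inherited by all rescaled frequencies, against their limit 1; a vanishing mask makes
  \<open>ft\<close> zero at its level, and this climbs back to \<open>\<xi>\<close>.\<close>

lemma ft_eq_0_iff_mask: "ft \<xi> = 0 \<longleftrightarrow> (\<exists>n. mask ((contr 0 ^^ Suc n) \<xi>) = 0)"
proof
  assume "ft \<xi> = 0"
  show "\<exists>n. mask ((contr 0 ^^ Suc n) \<xi>) = 0"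
  proof (rule ccontr)
    assume "\<nexists>n. mask ((contr 0 ^^ Suc n) \<xi>) = 0"
    then have "ft ((contr 0 ^^ n) \<xi>) = 0" for n
    proof (induction n)
      case (Suc n)
      then show ?case using ft_contr[of "(contr 0 ^^ n) \<xi>"] by simp
    qed (use \<open>ft \<xi> = 0\<close> in simp)
    then show False using ft_zoom_lim[of \<xi>] by (simp add: LIMSEQ_const_iff)
  qed
next
  assume "\<exists>n. mask ((contr 0 ^^ Suc n) \<xi>) = 0"
  then obtain n where "mask ((contr 0 ^^ Suc n) \<xi>) = 0" ..
  then have "ft ((contr 0 ^^ n) \<xi>) = 0" using ft_contr[of "(contr 0 ^^ n) \<xi>"] by simp
  then show "ft \<xi> = 0"
  proof (induction n)
    case (Suc n)
    then show ?case using ft_contr[of "(contr 0 ^^ n) \<xi>"] by simp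
  qed simp
qed

text \<open>Clearing the denominators turns the thirds into \<open>s q1\<close> and
  \<open>- s q2\<close>, and the integers into multiples of \<open>3 q1\<close> and
  \<open>3 q2\<close>, all scaled by \<open>A^n\<close>.\<close>

lemma ft_eq_0_iff: "ft \<xi> = 0 \<longleftrightarrow> (\<exists>w. zero_diff w \<and> \<xi> = of_int_pt w)"
proof -
  have eq1: "a / (3 * real_of_int q) ^ Suc n = t / 3 + of_int k \<longleftrightarrow>
      a = (3 * real_of_int q) ^ n * (t * of_int q + 3 * of_int q * of_int k)" if "q \<ge> 1" for a t :: real and q k n
    using that by (simp add: field_simps)
  have "ft \<xi> = 0 \<longleftrightarrow> (\<exists>n. \<exists>s\<in>{-1, 1::int}. \<exists>(k::int) (l::int).
      fst \<xi> / (3 * real_of_int q1) ^ Suc n = s / 3 + k \<and> snd \<xi> / (3 * real_of_int q2) ^ Suc n = - (s / 3) + l)"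
    unfolding ft_eq_0_iff_mask mask_def contr_0_funpow fst_conv snd_conv
    by (simp only: divide_eq_0_iff root3_sum_zero_iff) simp
  also have "\<dots> \<longleftrightarrow> (\<exists>n. \<exists>s\<in>{-1, 1::int}. \<exists>(k::int) (l::int).
      \<xi> = of_int_pt ((3 * q1) ^ n * (s * q1 + 3 * q1 * k), (3 * q2) ^ n * (- (s * q2) + 3 * q2 * l)))"
    unfolding prod_eq_iff of_int_pt_def minus_divide_left eq1[OF q1] eq1[OF q2] by simp
  also have "\<dots> \<longleftrightarrow> (\<exists>w. zero_diff w \<and> \<xi> = of_int_pt w)"
    unfolding zero_diff_def by blast
  finally show ?thesis .
qed

lemma orthogonal_iff: "(\<integral>x. expo l x * cnj (expo m x) \<partial>mu_AD q1 q2) = 0 \<longleftrightarrow> (\<exists>w. zero_diff w \<and> l - m = of_int_pt w)"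
  unfolding expo_mult_cnj ft_def[symmetric] by (rule ft_eq_0_iff)

end

section \<open>Balanced digit expansions\<close>

text \<open>Remainder in \<open>[-b/2, b/2)\<close>.\<close>

definition bal :: "int \<Rightarrow> int \<Rightarrow> int" where
  "bal b a = (a + b div 2) mod b - b div 2"

definition quo :: "int \<Rightarrow> int \<Rightarrow> int" where
  "quo b a = (a + b div 2) div b"

definition digit :: "int \<Rightarrow> int \<Rightarrow> nat \<Rightarrow> int" where
  "digit b a n = bal b ((quo b ^^ n) a)"

lemma bal_quo: "bal b a + b * quo b a = a"
proof -
  have "b * ((a + b div 2) div b) + (a + b div 2) mod b = a + b div 2" by (rule mult_div_mod_eq)
  then show ?thesis unfolding bal_def quo_def by linarith
qed

lemma bal_range:
  assumes "b > 0"
  shows "- b \<le> 2 * bal b a" "2 * bal b a < b"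
proof -
  define r h where "r = (a + b div 2) mod b" and "h = b div 2"
  have "0 \<le> r" "r < b" using assms by (simp_all add: r_def)
  moreover have "2 * h \<le> b" "b \<le> 2 * h + 1" unfolding h_def by linarith+
  moreover have "bal b a = r - h" by (simp add: bal_def r_def h_def)
  ultimately show "- b \<le> 2 * bal b a" "2 * bal b a < b" by simp_all
qed

lemma bal_add_mult:
  assumes "b > 0" "- b \<le> 2 * c" "2 * c < b"
  shows "bal b (c + b * k) = c" "quo b (c + b * k) = k"
proof -
  have r: "0 \<le> c + b div 2" "c + b div 2 < b" using assms by linarith+
  have e: "c + b * k + b div 2 = (c + b div 2) + b * k" by simp
  show "bal b (c + b * k) = c" "quo b (c + b * k) = k"
    unfolding bal_def quo_def e using r assms(1) by (simp_all add: div_mult_self2)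
qed

lemma bal_id: "b > 0 \<Longrightarrow> - b \<le> 2 * c \<Longrightarrow> 2 * c < b \<Longrightarrow> bal b c = c"
  using bal_add_mult(1)[of b c 0] by simp

lemma bal_eq_iff: "b > 0 \<Longrightarrow> bal b x = bal b y \<longleftrightarrow> b dvd x - y"
  unfolding bal_def by (simp add: mod_eq_dvd_iff)

lemma dvd_diff_bal: "b dvd x - bal b x"
  using bal_quo[of b x] by (metis add_diff_cancel_left' dvd_triv_left)

text \<open>Each common digit cancels in the difference and leaves a factor
  \<open>b\<close>.\<close>

lemma digits_agree_diff:
  assumes "\<And>k. k < n \<Longrightarrow> digit b x k = digit b y k"
  shows "x - y = b ^ n * ((quo b ^^ n) x - (quo b ^^ n) y)"
  using assms
proof (induction n)
  case (Suc n)
  let ?x = "(quo b ^^ n) x" and ?y = "(quo b ^^ n) y"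
  have "bal b ?x = bal b ?y" using Suc.prems[of n] by (simp add: digit_def)
  then have "?x - ?y = b * (quo b ?x - quo b ?y)"
    using bal_quo[of b ?x] bal_quo[of b ?y] by (simp add: right_diff_distrib)
  then show ?case using Suc by (simp add: mult.assoc)
qed simp

lemma digit_expansion: "x = (\<Sum>k<n. b ^ k * digit b x k) + b ^ n * (quo b ^^ n) x"
proof (induction n)
  case (Suc n)
  have "(quo b ^^ n) x = digit b x n + b * (quo b ^^ Suc n) x"
    using bal_quo[of b "(quo b ^^ n) x"] by (simp add: digit_def)
  then have "b ^ n * (quo b ^^ n) x = b ^ n * digit b x n + b ^ Suc n * (quo b ^^ Suc n) x"
    by (simp only: distrib_left power_Suc2 mult.assoc)
  then show ?case using Suc unfolding sum.lessThan_Suc by linarith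
qed simp

lemma quo_0: "b > 0 \<Longrightarrow> quo b 0 = 0"
  using bal_add_mult(2)[of b 0 0] by simp

text \<open>The remainder is at most \<open>b / 2\<close> in size, so
  \<open>|quo b x| >= |x|\<close> would give \<open>(b - 1) |x| <= b / 2\<close>, impossible for
  \<open>b >= 3\<close>. For \<open>b = 2\<close> the number 1 is fixed.\<close>

lemma quo_decreasing:
  assumes "b \<ge> 3" "x \<noteq> 0"
  shows "\<bar>quo b x\<bar> < \<bar>x\<bar>"
proof (rule ccontr)
  assume "\<not> \<bar>quo b x\<bar> < \<bar>x\<bar>"
  then have "\<bar>x\<bar> \<le> \<bar>quo b x\<bar>" by simp
  have "b * \<bar>quo b x\<bar> = \<bar>x - bal b x\<bar>"
    using bal_quo[of b x] assms(1) by (metis abs_mult abs_of_nonneg add_diff_cancel_left' order_trans zero_le_numeral)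
  then have "2 * (b * \<bar>quo b x\<bar>) \<le> 2 * \<bar>x\<bar> + b"
    using bal_range[of b x] assms(1) by linarith
  moreover have "b * \<bar>x\<bar> \<le> b * \<bar>quo b x\<bar>" using \<open>\<bar>x\<bar> \<le> _\<close> assms(1) by (intro mult_left_mono) auto
  moreover have "b * 1 \<le> b * \<bar>x\<bar>" "3 * \<bar>x\<bar> \<le> b * \<bar>x\<bar>"
    using assms by (intro mult_left_mono mult_right_mono; simp)+
  ultimately show False using assms by linarith
qed

text \<open>Sizes decrease until 0, which \<open>quo b\<close> fixes. Balanced digits thus give
  finite expansions of negative integers as well.\<close>

lemma quo_eventually_0:
  assumes "b \<ge> 3"
  shows "\<exists>N. \<forall>n\<ge>N. (quo b ^^ n) x = 0"
proof -
  have "\<exists>N. (quo b ^^ N) x = 0"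
  proof (induction "nat \<bar>x\<bar>" arbitrary: x rule: less_induct)
    case less
    show ?case
    proof (cases "x = 0")
      case True
      then show ?thesis by (intro exI[of _ 0]) simp
    next
      case False
      then have "nat \<bar>quo b x\<bar> < nat \<bar>x\<bar>" using quo_decreasing[OF assms False] by simp
      then obtain N where "(quo b ^^ N) (quo b x) = 0" using less by blast
      then show ?thesis by (intro exI[of _ "Suc N"]) (simp add: funpow_swap1)
    qed
  qed
  then obtain N where N: "(quo b ^^ N) x = 0" ..
  have "(quo b ^^ n) 0 = 0" for n using quo_0[of b] assms by (induction n) auto
  then have "(quo b ^^ n) x = 0" if "n \<ge> N" for n
    using N that funpow_add[of "n - N" N "quo b"] by simp
  then show ?thesis by blast
qed

text \<open>Horner's scheme, by induction on the number of places that may be nonzero.\<close>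

lemma digit_surj:
  assumes "b > 0" "\<And>k. - b \<le> 2 * c k \<and> 2 * c k < b" "\<And>k. k \<ge> N \<Longrightarrow> c k = 0"
  shows "\<exists>x. digit b x = c"
  using assms(2,3)
proof (induction N arbitrary: c)
  case 0
  have "(quo b ^^ n) 0 = 0" for n using quo_0[of b] assms(1) by (induction n) auto
  then have "digit b 0 k = c k" for k using 0 assms(1) bal_id[of b 0] by (simp add: digit_def)
  then show ?case by blast
next
  case (Suc N)
  from Suc.IH[of "\<lambda>k. c (Suc k)"] Suc.prems obtain x where x: "digit b x = (\<lambda>k. c (Suc k))" by auto
  have "digit b (c 0 + b * x) k = c k" for k
  proof (cases k)
    case 0
    then show ?thesis using bal_add_mult(1)[of b "c 0" x] Suc.prems(1)[of 0] assms(1) by (simp add: digit_def)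
  next
    case (Suc k')
    then have "digit b (c 0 + b * x) k = digit b x k'"
      using bal_add_mult(2)[of b "c 0" x] Suc.prems(1)[of 0] assms(1) by (simp add: digit_def funpow_swap1)
    then show ?thesis using x Suc by simp
  qed
  then show ?case by blast
qed

text \<open>Serves to compare the number of agreeing digits with the level in
  \<open>zero_diff\<close>.\<close>

lemma dvd_if_power_mult_eq:
  fixes b X Z :: int
  assumes eq: "b ^ n * X = b ^ m * Z" and "n < m" and b: "b \<noteq> 0"
  shows "b dvd X"
proof -
  obtain j where "m = n + Suc j" using \<open>n < m\<close> less_imp_Suc_add by (metis add_Suc_right)
  then have "b ^ n * X = b ^ n * (b * (b ^ j * Z))"
    using eq by (simp add: power_add mult_ac)
  then have "X = b * (b ^ j * Z)" using b by simp
  then show ?thesis by simp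
qed

section \<open>Words, prefixes and branches\<close>

lemma Theta3_cases: "j \<in> Theta3 \<longleftrightarrow> j = -1 \<or> j = 0 \<or> j = 1"
  by (auto simp: Theta3_def)

lemma prefix_Suc: "prefix I (Suc n) = prefix I n @ [I n]"
  by (simp add: prefix_def)

lemma length_prefix [simp]: "length (prefix I n) = n"
  by (simp add: prefix_def)

lemma nth_prefix: "k < n \<Longrightarrow> prefix I n ! k = I k"
  by (simp add: prefix_def)

lemma prefix_cong: "(\<And>k. k < n \<Longrightarrow> I k = J k) \<Longrightarrow> prefix I n = prefix J n"
  by (simp add: prefix_def)

lemma prefix_in_words: "(\<And>n. I n \<in> Theta3) \<Longrightarrow> prefix I (Suc n) \<in> words"
  by (auto simp: words_def prefix_def)

text \<open>Starting at prefix length 1 avoids the empty word and gives entry \<open>n\<close> the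
  weight \<open>A^n\<close> that it has in \<open>tau_star\<close>.\<close>

definition path :: "(int list \<Rightarrow> int \<times> int) \<Rightarrow> (nat \<Rightarrow> int) \<Rightarrow> nat \<Rightarrow> int \<times> int" where
  "path \<tau> I n = \<tau> (prefix I (Suc n))"

context sierpinski
begin

text \<open>The class \<open>cls g \<in> Eset\<close> and the position \<open>pos g \<in> Theta3\<close> of a digit \<open>g\<close> are determined by
  \<open>g = cls g + pos g * (q1, -q2)\<close> modulo \<open>A\<close>; \<open>enc\<close> inverts \<open>g \<mapsto> (cls g, pos g)\<close>.\<close>

definition pos :: "int \<times> int \<Rightarrow> int" where
  "pos g = (2 * fst g + q1) div (2 * q1)"

definition cls :: "int \<times> int \<Rightarrow> int \<times> int" where
  "cls g = (fst g - pos g * q1, bal (3 * q2) (snd g + pos g * q2))"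

definition enc :: "int \<times> int \<Rightarrow> int \<Rightarrow> int \<times> int" where
  "enc e j = (bal (3 * q1) (fst e + j * q1), bal (3 * q2) (snd e - j * q2))"

lemma Gamma_iff: "g \<in> Gamma q1 q2 \<longleftrightarrow>
    - (3 * q1) \<le> 2 * fst g \<and> 2 * fst g < 3 * q1 \<and> - (3 * q2) \<le> 2 * snd g \<and> 2 * snd g < 3 * q2"
  by (cases g) (auto simp: Gamma_def)

lemma Eset_iff: "e \<in> Eset q1 q2 \<longleftrightarrow>
    - q1 \<le> 2 * fst e \<and> 2 * fst e < q1 \<and> - (3 * q2) \<le> 2 * snd e \<and> 2 * snd e < 3 * q2"
  using q1 by (auto simp: Eset_def Gamma_iff)

lemma Gamma_eqI: "g \<in> Gamma q1 q2 \<Longrightarrow> h \<in> Gamma q1 q2 \<Longrightarrow> congA q1 q2 g h \<Longrightarrow> g = h"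
  using q1 q2 bal_eq_iff[of "3 * q1" "fst g" "fst h"] bal_eq_iff[of "3 * q2" "snd g" "snd h"]
  by (auto simp: Gamma_iff congA_def bal_id prod_eq_iff)

lemma enc_Gamma: "enc e j \<in> Gamma q1 q2"
  using q1 q2 bal_range[of "3 * q1" "fst e + j * q1"] bal_range[of "3 * q2" "snd e - j * q2"]
  by (simp add: Gamma_iff enc_def)

lemma congA_enc: "congA q1 q2 (enc e j) (e + vq q1 q2 j)"
  unfolding congA_def enc_def vq_def
  using dvd_diff_bal[of "3 * q1" "fst e + j * q1"] dvd_diff_bal[of "3 * q2" "snd e - j * q2"]
  by (simp add: dvd_diff_commute)

lemma congA_sym: "congA q1 q2 x y \<Longrightarrow> congA q1 q2 y x"
  by (simp add: congA_def dvd_diff_commute)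

lemma congA_trans [trans]: "congA q1 q2 x y \<Longrightarrow> congA q1 q2 y z \<Longrightarrow> congA q1 q2 x z"
  unfolding congA_def by (metis diff_add_cancel add_diff_eq dvd_add)

lemma enc_eqI: "g \<in> Gamma q1 q2 \<Longrightarrow> congA q1 q2 g (e + vq q1 q2 j) \<Longrightarrow> g = enc e j"
  using Gamma_eqI[OF _ enc_Gamma] congA_trans congA_sym congA_enc by blast

text \<open>Division by \<open>2 q1\<close> after adding \<open>q1\<close> rounds
  \<open>fst g / q1\<close> to a nearest integer, so the remainder meets the bound that defines
  \<open>Eset\<close>. The position thus depends on the first coordinate alone.\<close>

lemma pos_bounds: "- q1 \<le> 2 * (fst g - pos g * q1)" "2 * (fst g - pos g * q1) < q1"
proof -
  have "2 * q1 * pos g + (2 * fst g + q1) mod (2 * q1) = 2 * fst g + q1"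
    unfolding pos_def by (rule mult_div_mod_eq)
  moreover have "0 \<le> (2 * fst g + q1) mod (2 * q1)" "(2 * fst g + q1) mod (2 * q1) < 2 * q1"
    using q1 by simp_all
  ultimately show "- q1 \<le> 2 * (fst g - pos g * q1)" "2 * (fst g - pos g * q1) < q1"
    by (simp_all add: algebra_simps)
qed

lemma pos_eqI:
  assumes "- q1 \<le> 2 * (fst g - j * q1)" "2 * (fst g - j * q1) < q1"
  shows "pos g = j"
  unfolding pos_def
  by (rule int_div_pos_eq[where r = "2 * (fst g - j * q1) + q1"]) (use assms in \<open>simp_all add: algebra_simps\<close>)

lemma pos_Theta3:
  assumes "g \<in> Gamma q1 q2"
  shows "pos g \<in> Theta3"
proof -
  define u where "u = pos g * q1"
  have "- q1 \<le> 2 * (fst g - u)" "2 * (fst g - u) < q1" using pos_bounds[of g] by (simp_all add: u_def)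
  then have "u < 2 * q1" "(-2) * q1 < u" using assms by (auto simp: Gamma_iff)
  then have "pos g < 2" "-2 < pos g" unfolding u_def using q1 by (simp_all only: mult_less_cancel_right_disj) auto
  then show ?thesis by (auto simp: Theta3_cases)
qed

lemma cls_Eset: "cls g \<in> Eset q1 q2"
  using pos_bounds[of g] bal_range[of "3 * q2" "snd g + pos g * q2"] q2 by (simp add: Eset_iff cls_def)

lemma enc_cls_pos:
  assumes "g \<in> Gamma q1 q2"
  shows "enc (cls g) (pos g) = g"
proof (rule enc_eqI[OF assms, symmetric])
  show "congA q1 q2 g (cls g + vq q1 q2 (pos g))"
    using dvd_diff_bal[of "3 * q2" "snd g + pos g * q2"]
    by (simp add: congA_def cls_def vq_def algebra_simps)
qed

text \<open>A shift by at most \<open>q1\<close> keeps the first coordinate in the range of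
  \<open>Gamma\<close>; only the second one can wrap around.\<close>

lemma fst_enc:
  assumes "e \<in> Eset q1 q2" "j \<in> Theta3"
  shows "fst (enc e j) = fst e + j * q1"
  using assms q1 unfolding enc_def fst_conv by (intro bal_id) (auto simp: Eset_iff Theta3_cases)

lemma pos_enc:
  assumes "e \<in> Eset q1 q2" "j \<in> Theta3"
  shows "pos (enc e j) = j"
  using assms by (intro pos_eqI) (auto simp: fst_enc Eset_iff)

lemma cls_enc:
  assumes "e \<in> Eset q1 q2" "j \<in> Theta3"
  shows "cls (enc e j) = e"
proof -
  have "bal (3 * q2) (snd (enc e j) + j * q2) = bal (3 * q2) (snd e)"
    using dvd_diff_bal[of "3 * q2" "snd e - j * q2"] q2
    by (subst bal_eq_iff) (auto simp: enc_def dvd_diff_commute algebra_simps)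
  also have "\<dots> = snd e" using assms(1) q2 by (intro bal_id) (auto simp: Eset_iff)
  finally show ?thesis using assms by (simp add: cls_def pos_enc fst_enc prod_eq_iff)
qed

lemma zero_Gamma: "0 \<in> Gamma q1 q2" and zero_Eset: "0 \<in> Eset q1 q2"
  using q1 q2 by (auto simp: Gamma_iff Eset_iff)

lemma enc_0: "j \<in> Theta3 \<Longrightarrow> enc 0 j = vq q1 q2 j"
  using q1 q2 unfolding enc_def vq_def by (auto simp: Theta3_cases intro!: bal_id)

lemma pos_0 [simp]: "pos 0 = 0" and cls_0 [simp]: "cls 0 = 0"
proof -
  have "enc 0 0 = 0" using enc_0[of 0] by (simp add: Theta3_cases vq_def zero_prod_def)
  then show "pos 0 = 0" "cls 0 = 0"
    using pos_enc[OF zero_Eset, of 0] cls_enc[OF zero_Eset, of 0] by (auto simp: Theta3_cases)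
qed

text \<open>Since \<open>3 (q1, -q2)\<close> lies in \<open>A Z^2\<close>, positions matter only
  modulo 3.\<close>

lemma congA_vq: "3 dvd i - j \<Longrightarrow> congA q1 q2 (x + vq q1 q2 i) (x + vq q1 q2 j)"
  by (auto simp: congA_def vq_def simp flip: left_diff_distrib) (metis mult_dvd_mono dvd_refl minus_diff_eq dvd_minus_iff)

lemma congA_add_right: "congA q1 q2 x y \<Longrightarrow> congA q1 q2 (x + z) (y + z)"
  by (simp add: congA_def)

lemma vq_add: "vq q1 q2 (i + j) = vq q1 q2 i + vq q1 q2 j"
  by (simp add: vq_def algebra_simps)

lemma cls_eq_imp_congA:
  assumes "g \<in> Gamma q1 q2" "h \<in> Gamma q1 q2" "cls g = cls h" "g \<noteq> h"
  shows "\<exists>s\<in>{-1, 1}. congA q1 q2 g (h + vq q1 q2 s)"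
proof -
  have ne: "pos g \<noteq> pos h" using assms enc_cls_pos by metis
  \<comment> \<open>Distinct elements of \<open>Theta3\<close> differ by 1 or -1 modulo 3.\<close>
  then have "\<exists>s\<in>{-1, 1}. 3 dvd pos g - (pos h + s)"
    using pos_Theta3[OF assms(1)] pos_Theta3[OF assms(2)] by (auto simp: Theta3_cases)
  then obtain s where s: "s \<in> {-1, 1}" "3 dvd pos g - (pos h + s)" by blast
  have "congA q1 q2 g (cls h + vq q1 q2 (pos g))" using congA_enc enc_cls_pos assms(1,3) by metis
  also have "congA q1 q2 \<dots> (cls h + vq q1 q2 (pos h + s))" by (rule congA_vq[OF s(2)])
  also have "congA q1 q2 \<dots> (h + vq q1 q2 s)"
    unfolding vq_add add.assoc[symmetric]
    by (rule congA_add_right, rule congA_sym) (metis congA_enc enc_cls_pos assms(2))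
  finally show ?thesis using s(1) by blast
qed

lemma congA_imp_cls_eq:
  assumes "g \<in> Gamma q1 q2" "h \<in> Gamma q1 q2" "congA q1 q2 g (h + vq q1 q2 s)"
  shows "cls g = cls h"
proof -
  \<comment> \<open>The shifted position is folded back into \<open>Theta3\<close> modulo 3.\<close>
  define j where "j = bal 3 (pos h + s)"
  have j: "j \<in> Theta3" "3 dvd pos h + s - j"
    using bal_range[of 3 "pos h + s"] dvd_diff_bal[of 3 "pos h + s"] by (auto simp: j_def Theta3_cases)
  have "congA q1 q2 g (h + vq q1 q2 s)" by fact
  also have "congA q1 q2 \<dots> (cls h + vq q1 q2 (pos h + s))"
    unfolding vq_add add.assoc[symmetric]
    by (rule congA_add_right) (metis congA_enc enc_cls_pos assms(2))
  also have "congA q1 q2 \<dots> (cls h + vq q1 q2 j)" by (rule congA_vq[OF j(2)])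
  finally have "g = enc (cls h) j" by (rule enc_eqI[OF assms(1)])
  then show ?thesis using cls_enc[OF cls_Eset j(1)] by simp
qed

section \<open>Integer points as digit sequences\<close>

definition seqs :: "(nat \<Rightarrow> int \<times> int) set" where
  "seqs = {c. (\<forall>n. c n \<in> Gamma q1 q2) \<and> (\<exists>N. \<forall>n\<ge>N. c n = 0)}"

definition dig :: "int \<times> int \<Rightarrow> nat \<Rightarrow> int \<times> int" where
  "dig x n = (digit (3 * q1) (fst x) n, digit (3 * q2) (snd x) n)"

text \<open>At the first index where \<open>c\<close> and \<open>d\<close> differ their classes agree; this includes \<open>c = d\<close>, and beyond the
  first difference the condition is void.\<close>

definition compat :: "(nat \<Rightarrow> int \<times> int) \<Rightarrow> (nat \<Rightarrow> int \<times> int) \<Rightarrow> bool" where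
  "compat c d \<longleftrightarrow> (\<forall>n. (\<forall>k<n. c k = d k) \<longrightarrow> cls (c n) = cls (d n))"

lemma dig_Gamma: "dig x n \<in> Gamma q1 q2"
  using q1 q2 bal_range[of "3 * q1"] bal_range[of "3 * q2"] by (simp add: Gamma_iff dig_def digit_def)

lemma dig_eventually_0:
  "\<exists>N. \<forall>n\<ge>N. dig x n = 0 \<and> (quo (3 * q1) ^^ n) (fst x) = 0 \<and> (quo (3 * q2) ^^ n) (snd x) = 0"
proof -
  obtain N M where "\<forall>n\<ge>N. (quo (3 * q1) ^^ n) (fst x) = 0" "\<forall>n\<ge>M. (quo (3 * q2) ^^ n) (snd x) = 0"
    using quo_eventually_0[of "3 * q1"] quo_eventually_0[of "3 * q2"] q1 q2 by force
  then show ?thesis using q1 q2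
    by (intro exI[of _ "max N M"]) (auto simp: dig_def digit_def bal_id zero_prod_def)
qed

lemma dig_seqs: "dig x \<in> seqs"
  using dig_Gamma dig_eventually_0[of x] by (auto simp: seqs_def)

lemma dig_agree_diff:
  assumes "\<And>k. k < n \<Longrightarrow> dig x k = dig y k"
  shows "fst x - fst y = (3 * q1) ^ n * ((quo (3 * q1) ^^ n) (fst x) - (quo (3 * q1) ^^ n) (fst y))"
    "snd x - snd y = (3 * q2) ^ n * ((quo (3 * q2) ^^ n) (snd x) - (quo (3 * q2) ^^ n) (snd y))"
  by (rule digits_agree_diff, use assms in \<open>simp add: dig_def\<close>)+

text \<open>Beyond the ends of both expansions the quotients are 0, so common digits leave no
  difference.\<close>

lemma inj_dig: "inj dig"
proof (rule injI)
  fix x y assume eq: "dig x = dig y"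
  obtain N M where "\<forall>n\<ge>N. (quo (3 * q1) ^^ n) (fst x) = 0 \<and> (quo (3 * q2) ^^ n) (snd x) = 0"
    "\<forall>n\<ge>M. (quo (3 * q1) ^^ n) (fst y) = 0 \<and> (quo (3 * q2) ^^ n) (snd y) = 0"
    using dig_eventually_0 by meson
  then show "x = y" using dig_agree_diff[of "max N M" x y] eq by (simp add: prod_eq_iff)
qed

lemma dig_surj:
  assumes "c \<in> seqs"
  obtains x where "dig x = c"
proof -
  obtain N where N: "\<And>n. n \<ge> N \<Longrightarrow> c n = 0" using assms by (auto simp: seqs_def)
  have G: "c n \<in> Gamma q1 q2" for n using assms by (simp add: seqs_def)
  have "\<exists>x. digit (3 * q1) x = (\<lambda>n. fst (c n))"
    by (rule digit_surj[of _ _ N]) (use q1 G N in \<open>auto simp: Gamma_iff\<close>)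
  moreover have "\<exists>x. digit (3 * q2) x = (\<lambda>n. snd (c n))"
    by (rule digit_surj[of _ _ N]) (use q2 G N in \<open>auto simp: Gamma_iff\<close>)
  ultimately obtain x1 x2 where "digit (3 * q1) x1 = (\<lambda>n. fst (c n))" "digit (3 * q2) x2 = (\<lambda>n. snd (c n))" by blast
  then have "dig (x1, x2) = c" by (simp add: dig_def fun_eq_iff)
  then show thesis by (rule that)
qed

text \<open>Agreement below the first difference \<open>n\<close> yields the factor
  \<open>A^n\<close>; equal classes at \<open>n\<close> make the digits differ by plus or minus
  \<open>(q1, -q2)\<close> modulo \<open>A\<close>.\<close>

lemma compat_imp_zero_diff:
  assumes "compat (dig x) (dig y)" "x \<noteq> y"
  shows "zero_diff (x - y)"
proof -
  have "\<exists>n. dig x n \<noteq> dig y n" using assms(2) inj_dig by (metis injD ext)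
  then obtain n where n: "dig x n \<noteq> dig y n" and below: "\<And>k. k < n \<Longrightarrow> dig x k = dig y k"
    by (auto dest: ex_least_nat_le elim: exists_least_iff[THEN iffD1, THEN exE])
  have "cls (dig x n) = cls (dig y n)" using assms(1) below by (simp add: compat_def)
  from cls_eq_imp_congA[OF dig_Gamma dig_Gamma this n]
  obtain s where s: "s \<in> {-1, 1}" "congA q1 q2 (dig x n) (dig y n + vq q1 q2 s)" by blast
  let ?X1 = "(quo (3 * q1) ^^ n) (fst x)" and ?X2 = "(quo (3 * q2) ^^ n) (snd x)"
    and ?Y1 = "(quo (3 * q1) ^^ n) (fst y)" and ?Y2 = "(quo (3 * q2) ^^ n) (snd y)"
  have "3 * q1 dvd digit (3 * q1) (fst x) n - (digit (3 * q1) (fst y) n + s * q1)"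
    "3 * q2 dvd digit (3 * q2) (snd x) n - (digit (3 * q2) (snd y) n - s * q2)"
    using s(2) by (auto simp: congA_def dig_def vq_def)
  then obtain k l where kl: "digit (3 * q1) (fst x) n = digit (3 * q1) (fst y) n + s * q1 + 3 * q1 * k"
    "digit (3 * q2) (snd x) n = digit (3 * q2) (snd y) n - s * q2 + 3 * q2 * l"
    by (metis add.commute diff_add_cancel dvdE)
  \<comment> \<open>The higher quotients only change the multiplier of \<open>3 q1\<close>.\<close>
  have "?X1 - ?Y1 = s * q1 + 3 * q1 * (k + quo (3 * q1) ?X1 - quo (3 * q1) ?Y1)"
    using bal_quo[of "3 * q1" ?X1] bal_quo[of "3 * q1" ?Y1] kl(1) unfolding digit_def by (simp add: algebra_simps)
  moreover have "?X2 - ?Y2 = - (s * q2) + 3 * q2 * (l + quo (3 * q2) ?X2 - quo (3 * q2) ?Y2)"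
    using bal_quo[of "3 * q2" ?X2] bal_quo[of "3 * q2" ?Y2] kl(2) unfolding digit_def by (simp add: algebra_simps)
  ultimately show ?thesis using s(1) dig_agree_diff[OF below]
    unfolding zero_diff_def prod_eq_iff fst_conv snd_conv fst_diff snd_diff by metis
qed

text \<open>Let \<open>m\<close> be the level in \<open>zero_diff\<close> and let \<open>n\<close>
  places agree. The digits at \<open>n\<close> are equal if \<open>n < m\<close> and lie in one
  class if \<open>n = m\<close>; \<open>n > m\<close> cannot occur.\<close>

lemma zero_diff_imp_compat:
  assumes "zero_diff (x - y)"
  shows "compat (dig x) (dig y)"
  unfolding compat_def
proof (intro allI impI)
  fix n assume "\<forall>k<n. dig x k = dig y k"
  note diff = dig_agree_diff[of n x y, OF this[rule_format]]
  let ?X1 = "(quo (3 * q1) ^^ n) (fst x)" and ?X2 = "(quo (3 * q2) ^^ n) (snd x)"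
    and ?Y1 = "(quo (3 * q1) ^^ n) (fst y)" and ?Y2 = "(quo (3 * q2) ^^ n) (snd y)"
  obtain m s k l where m: "s \<in> {-1, 1}"
    "fst x - fst y = (3 * q1) ^ m * (s * q1 + 3 * q1 * k)"
    "snd x - snd y = (3 * q2) ^ m * (- (s * q2) + 3 * q2 * l)"
    using assms unfolding zero_diff_def prod_eq_iff fst_conv snd_conv fst_diff snd_diff by blast
  have nz: "3 * q1 \<noteq> 0" "3 * q2 \<noteq> 0" using q1 q2 by auto
  consider "n < m" | "n = m" | "m < n" by linarith
  then show "cls (dig x n) = cls (dig y n)"
  proof cases
    case 1
    have "3 * q1 dvd ?X1 - ?Y1" by (rule dvd_if_power_mult_eq[OF trans[OF diff(1)[symmetric] m(2)] 1 nz(1)])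
    moreover have "3 * q2 dvd ?X2 - ?Y2" by (rule dvd_if_power_mult_eq[OF trans[OF diff(2)[symmetric] m(3)] 1 nz(2)])
    ultimately have "dig x n = dig y n" using q1 q2 by (simp add: dig_def digit_def bal_eq_iff)
    then show ?thesis by simp
  next
    case 2
    have e: "?X1 - ?Y1 = s * q1 + 3 * q1 * k" "?X2 - ?Y2 = - (s * q2) + 3 * q2 * l"
      using diff m(2,3) 2 q1 q2 by simp_all
    have "digit (3 * q1) (fst x) n - (digit (3 * q1) (fst y) n + s * q1) = 3 * q1 * (k - quo (3 * q1) ?X1 + quo (3 * q1) ?Y1)"
      using bal_quo[of "3 * q1" ?X1] bal_quo[of "3 * q1" ?Y1] e(1) unfolding digit_def by (simp add: algebra_simps)
    moreover have "digit (3 * q2) (snd x) n - (digit (3 * q2) (snd y) n - s * q2) = 3 * q2 * (l - quo (3 * q2) ?X2 + quo (3 * q2) ?Y2)"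
      using bal_quo[of "3 * q2" ?X2] bal_quo[of "3 * q2" ?Y2] e(2) unfolding digit_def by (simp add: algebra_simps)
    ultimately have "congA q1 q2 (dig x n) (dig y n + vq q1 q2 s)"
      by (simp add: congA_def dig_def vq_def)
    then show ?thesis by (rule congA_imp_cls_eq[OF dig_Gamma dig_Gamma])
  next
    case 3
    \<comment> \<open>Agreement past place \<open>m\<close> would force 3 to divide
      \<open>s\<close>, which is 1 or -1.\<close>
    have "3 * q1 dvd s * q1 + 3 * q1 * k"
      by (rule dvd_if_power_mult_eq[OF trans[OF m(2)[symmetric] diff(1)] 3 nz(1)])
    then have "q1 * 3 dvd q1 * s" by (simp add: dvd_add_left_iff mult.commute)
    then have "3 dvd s" using q1 by (subst (asm) dvd_mult_cancel_left) auto
    then show ?thesis using m(1) by auto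
  qed
qed

section \<open>Maximal families and trees\<close>

lemma seqsE:
  assumes "c \<in> seqs"
  obtains N where "\<And>n. n \<ge> N \<Longrightarrow> c n = 0"
  using assms by (auto simp: seqs_def)

lemma mtm_Gamma: "maximal_tree_mapping q1 q2 \<tau> \<Longrightarrow> I \<in> words \<Longrightarrow> \<tau> I \<in> Gamma q1 q2"
  by (simp add: maximal_tree_mapping_def)

lemma path_seqs:
  assumes "maximal_tree_mapping q1 q2 \<tau>" "I \<in> Theta_tau \<tau>"
  shows "path \<tau> I \<in> seqs"
proof -
  obtain N where N: "\<And>n. n \<ge> N \<Longrightarrow> \<tau> (prefix I n) = 0" and I: "\<And>n. I n \<in> Theta3"
    using assms(2) by (auto simp: Theta_tau_def)
  have "path \<tau> I n = 0" if "n \<ge> N" for n using N[of "Suc n"] that by (simp add: path_def)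
  moreover have "path \<tau> I n \<in> Gamma q1 q2" for n
    unfolding path_def by (intro mtm_Gamma[OF assms(1)] prefix_in_words I)
  ultimately show ?thesis by (auto simp: seqs_def)
qed

text \<open>Maximality is tested by adding single sequences, which suffices because compatibility is
  a condition on pairs.\<close>

definition maximal_compat :: "(nat \<Rightarrow> int \<times> int) set \<Rightarrow> bool" where
  "maximal_compat C \<longleftrightarrow> (\<forall>c\<in>C. \<forall>d\<in>C. compat c d) \<and> (\<forall>d\<in>seqs. (\<forall>c\<in>C. compat d c) \<longrightarrow> d \<in> C)"

lemma compat_sym: "compat c d \<Longrightarrow> compat d c"
  by (simp add: compat_def)

text \<open>Positions serve as addresses: agreement below \<open>k\<close> makes the classes at
  \<open>k\<close> equal, and class and position determine the digit.\<close>

lemma agree_if_pos_agree: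
  assumes "compat c d" "c \<in> seqs" "d \<in> seqs" "\<And>k. k < n \<Longrightarrow> pos (c k) = pos (d k)" "k < n"
  shows "c k = d k"
  using assms(5)
proof (induction k rule: less_induct)
  case (less k)
  then have "cls (c k) = cls (d k)" using assms(1) by (auto simp: compat_def)
  moreover have "pos (c k) = pos (d k)" using assms(4) less.prems by simp
  ultimately show ?case using enc_cls_pos assms(2,3) by (metis (mono_tags, lifting) mem_Collect_eq seqs_def)
qed

text \<open>If a child were missing, the sequence through it that ends in zeros could be added to \<open>C\<close>.\<close>

lemma maximal_compat_branches:
  assumes C: "maximal_compat C" "C \<subseteq> seqs" "(\<lambda>_. 0) \<in> C" and I: "set I \<subseteq> Theta3"
  shows "\<exists>c\<in>C. \<forall>k<length I. pos (c k) = I ! k"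
  using I
proof (induction I rule: rev_induct)
  case (snoc j I)
  let ?n = "length I"
  from snoc obtain c where c: "c \<in> C" "\<And>k. k < ?n \<Longrightarrow> pos (c k) = I ! k" by auto
  have j: "j \<in> Theta3" using snoc.prems by simp
  show ?case
  proof (rule ccontr)
    assume "\<not> ?case"
    then have none: "\<exists>k<Suc ?n. pos (d k) \<noteq> (I @ [j]) ! k" if "d \<in> C" for d using that by auto
    \<comment> \<open>\<open>c'\<close> follows \<open>c\<close>, takes the missing child within the
      class found there, and ends in zeros so as to lie in \<open>seqs\<close>.\<close>
    define c' where "c' k = (if k < ?n then c k else if k = ?n then enc (cls (c k)) j else 0)" for k
    have c': "c' k = c k" if "k < ?n" for k using that by (simp add: c'_def)
    have pos': "pos (c' k) = (I @ [j]) ! k" if "k < Suc ?n" for k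
      using that c(2) pos_enc[OF cls_Eset j] by (auto simp: c'_def nth_append less_Suc_eq)
    have "c' \<in> seqs"
    proof -
      have "c' k \<in> Gamma q1 q2" for k
        using C(2) c(1) by (auto simp: c'_def enc_Gamma zero_Gamma seqs_def)
      moreover have "\<forall>k\<ge>Suc ?n. c' k = 0" by (simp add: c'_def)
      ultimately show ?thesis unfolding seqs_def by blast
    qed
    moreover have "compat c' d" if d: "d \<in> C" for d
      unfolding compat_def
    proof (intro allI impI)
      fix m assume agree: "\<forall>k<m. c' k = d k"
      have cd: "compat c d" using C(1) c(1) d by (simp add: maximal_compat_def)
      consider "m < ?n" | "m = ?n" | "m > ?n" by linarith
      then show "cls (c' m) = cls (d m)"
      proof cases
        case 1
        then show ?thesis using cd agree c' by (auto simp: compat_def)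
      next
        case 2
        then have "cls (c m) = cls (d m)" using cd agree c' by (auto simp: compat_def)
        then show ?thesis using 2 cls_enc[OF cls_Eset j] by (simp add: c'_def)
      next
        case 3
        \<comment> \<open>Agreement past \<open>?n\<close> would lead \<open>d\<close> through the
          missing child.\<close>
        then have "pos (d k) = (I @ [j]) ! k" if "k < Suc ?n" for k using agree pos'[OF that] that by simp
        then show ?thesis using none[OF d] by blast
      qed
    qed
    ultimately have "c' \<in> C" using C(1) by (simp add: maximal_compat_def)
    then show False using none pos' by blast
  qed
qed (use C(3) in auto)

text \<open>A node is addressed by the positions leading to it. \<open>K\<close> is the common class
  of its children, and \<open>\<tau>\<close> recovers a digit from the class at the parent and the
  last letter.\<close>

lemma maximal_compat_imp_tree:
  assumes C: "maximal_compat C" "C \<subseteq> seqs" "(\<lambda>_. 0) \<in> C"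
  shows "\<exists>\<tau>. maximal_tree_mapping q1 q2 \<tau> \<and> C = path \<tau> ` Theta_tau \<tau>"
proof -
  define through where "through I c \<longleftrightarrow> c \<in> C \<and> (\<forall>k<length I. pos (c k) = I ! k)" for I c
  define K where "K I = cls ((SOME c. through I c) (length I))" for I
  define \<tau> where "\<tau> I = enc (K (butlast I)) (last I)" for I
  have ex: "\<exists>c. through I c" if "set I \<subseteq> Theta3" for I
    using maximal_compat_branches[OF C that] by (auto simp: through_def)
  \<comment> \<open>All sequences through a node agree up to it, so the choice made in
    \<open>K\<close> does not matter.\<close>
  have K: "K I = cls (c (length I))" if "through I c" for I c
  proof -
    let ?d = "SOME c. through I c"
    have d: "through I ?d" by (rule someI[of "through I", OF that])
    with that have cp: "compat ?d c" using that C(1) by (auto simp: through_def maximal_compat_def)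
    have "?d k = c k" if "k < length I" for k
      by (rule agree_if_pos_agree[OF cp _ _ _ that]) (use d \<open>through I c\<close> C(2) in \<open>auto simp: through_def\<close>)
    then show ?thesis using cp by (simp add: K_def compat_def)
  qed
  have KE: "K I \<in> Eset q1 q2" for I by (simp add: K_def cls_Eset)
  have \<tau>_snoc: "\<tau> (I @ [j]) = enc (K I) j" for I j by (simp add: \<tau>_def)
  have posC: "pos (c n) \<in> Theta3" if "c \<in> C" for c n
    using that C(2) by (intro pos_Theta3) (auto simp: seqs_def)
  have pathC: "path \<tau> I n = c n" if "c \<in> C" "\<And>k. k \<le> n \<Longrightarrow> I k = pos (c k)" for c I n
  proof -
    have "through (prefix I n) c" using that by (simp add: through_def nth_prefix)
    from K[OF this] have "path \<tau> I n = enc (cls (c n)) (pos (c n))"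
      using that(2)[of n] by (simp add: path_def prefix_Suc \<tau>_snoc)
    also have "\<dots> = c n" using that(1) C(2) by (intro enc_cls_pos) (auto simp: seqs_def)
    finally show ?thesis .
  qed
  have mtm: "maximal_tree_mapping q1 q2 \<tau>"
    unfolding maximal_tree_mapping_def
  proof (intro conjI ballI allI impI)
    show "\<tau> I \<in> Gamma q1 q2" for I by (simp add: \<tau>_def enc_Gamma)
    show "\<tau> (replicate k 0 @ [i]) = vq q1 q2 i" if "i \<in> Theta3" for k i
    proof -
      have "through (replicate k 0) (\<lambda>_. 0)" using C(3) by (simp add: through_def)
      from K[OF this] show ?thesis using that by (simp add: \<tau>_snoc enc_0)
    qed
    show "\<exists>e\<in>Eset q1 q2. \<forall>j\<in>Theta3. congA q1 q2 (\<tau> (I @ [j])) (e + vq q1 q2 j)" for I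
      unfolding \<tau>_snoc using KE congA_enc by blast
    fix I assume I: "I \<in> words"
    then obtain c where c: "through I c" using ex by (auto simp: words_def)
    then have cC: "c \<in> C" by (simp add: through_def)
    from subsetD[OF C(2) this] obtain M where M: "\<And>n. n \<ge> M \<Longrightarrow> c n = 0" by (rule seqsE) (rule that)
    \<comment> \<open>The positions of \<open>c\<close> beyond \<open>I\<close>, taken far enough
      that only zeros follow. There are \<open>M + 1\<close> of them, so \<open>J\<close> is
      nonempty even if \<open>M = 0\<close>.\<close>
    define J where "J = map (\<lambda>k. pos (c k)) [length I..<Suc (length I + M)]"
    have J: "J \<in> words" using posC[OF cC] by (auto simp: J_def words_def)
    have "\<tau> (I @ J @ replicate n 0) = 0" for n
    proof -
      let ?m = "length I + M + n"
      have e: "I @ J @ replicate n 0 = prefix (\<lambda>k. pos (c k)) (Suc ?m)"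
      proof (rule nth_equalityI)
        fix i assume i: "i < length (I @ J @ replicate n 0)"
        then have im: "i < Suc ?m" by (simp add: J_def del: upt_Suc)
        show "(I @ J @ replicate n 0) ! i = prefix (\<lambda>k. pos (c k)) (Suc ?m) ! i"
        proof (cases "i < length I")
          case True
          then show ?thesis using c im by (simp add: nth_append nth_prefix through_def)
        next
          case False
          then show ?thesis using im M[of i]
            by (cases "i < Suc (length I + M)") (simp_all add: nth_append nth_prefix J_def del: upt_Suc)
        qed
      qed (simp add: J_def del: upt_Suc)
      show ?thesis unfolding e using pathC[OF cC, of ?m "\<lambda>k. pos (c k)"] M[of ?m] by (simp add: path_def)
    qed
    then show "\<exists>J\<in>words. \<exists>N. \<forall>n\<ge>N. \<tau> (I @ J @ replicate n 0) = 0" using J by blast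
  qed
  moreover have "C = path \<tau> ` Theta_tau \<tau>"
  proof (intro equalityI subsetI)
    fix c assume c: "c \<in> C"
    from subsetD[OF C(2) this] obtain M where M: "\<And>n. n \<ge> M \<Longrightarrow> c n = 0" by (rule seqsE) (rule that)
    let ?I = "\<lambda>k. pos (c k)"
    have p: "path \<tau> ?I n = c n" for n by (rule pathC[OF c]) simp
    have "\<tau> (prefix ?I n) = 0" if "n \<ge> Suc M" for n
      using p[of "n - 1"] M[of "n - 1"] that by (simp add: path_def)
    then have "?I \<in> Theta_tau \<tau>" using posC[OF c] by (auto simp: Theta_tau_def)
    moreover have "c = path \<tau> ?I" using p by auto
    ultimately show "c \<in> path \<tau> ` Theta_tau \<tau>" by blast
  next
    fix c assume "c \<in> path \<tau> ` Theta_tau \<tau>"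
    then obtain I where I: "I \<in> Theta_tau \<tau>" "c = path \<tau> I" by blast
    have I3: "I n \<in> Theta3" for n using I(1) by (simp add: Theta_tau_def)
    have cI: "cls (c n) = K (prefix I n)" "pos (c n) = I n" for n
      unfolding I(2) path_def prefix_Suc \<tau>_snoc by (intro cls_enc pos_enc KE I3)+
    \<comment> \<open>If \<open>d\<close> agrees with \<open>c\<close> below \<open>n\<close>, it
      runs through the node \<open>prefix I n\<close>, whose class is that of \<open>c n\<close>.
      Maximality then puts the branch \<open>c\<close> into \<open>C\<close>.\<close>
    have "compat c d" if d: "d \<in> C" for d
      unfolding compat_def
    proof (intro allI impI)
      fix n assume agree: "\<forall>k<n. c k = d k"
      have "pos (d k) = I k" if "k < n" for k using agree cI(2)[of k] that by simp
      then have "through (prefix I n) d" using d by (simp add: through_def nth_prefix)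
      from K[OF this] show "cls (c n) = cls (d n)" by (simp add: cI(1))
    qed
    moreover have "c \<in> seqs" unfolding I(2) by (rule path_seqs[OF mtm I(1)])
    ultimately show "c \<in> C" using C(1) by (simp add: maximal_compat_def)
  qed
  ultimately show ?thesis by blast
qed

text \<open>Branches that agree so far have the same prefix, hence the same class next. For
  maximality, a sequence compatible with all branches is shown digit by digit to follow the tree
  along its own positions.\<close>

lemma tree_imp_maximal_compat:
  assumes \<tau>: "maximal_tree_mapping q1 q2 \<tau>"
  shows "maximal_compat (path \<tau> ` Theta_tau \<tau>)"
proof -
  \<comment> \<open>Conditions (i) and (ii) merge into one: zero words, the empty one included, have
    class 0.\<close>
  have "\<exists>e\<in>Eset q1 q2. \<forall>j\<in>Theta3. \<tau> (I @ [j]) = enc e j" if I: "set I \<subseteq> Theta3" for I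
  proof (cases "I = replicate (length I) 0")
    case True
    have "\<forall>j\<in>Theta3. \<tau> (I @ [j]) = enc 0 j"
      using \<tau> by (subst True) (auto simp: maximal_tree_mapping_def enc_0)
    then show ?thesis using zero_Eset by blast
  next
    case False
    then have "I \<in> words" "length I \<ge> 1" using I by (auto simp: words_def Suc_le_eq)
    then obtain e where e: "e \<in> Eset q1 q2" "\<forall>j\<in>Theta3. congA q1 q2 (\<tau> (I @ [j])) (e + vq q1 q2 j)"
      using \<tau> False unfolding maximal_tree_mapping_def by blast
    have "\<tau> (I @ [j]) = enc e j" if "j \<in> Theta3" for j
      using e(2) that I by (intro enc_eqI mtm_Gamma[OF \<tau>]) (auto simp: words_def)
    then show ?thesis using e(1) by blast
  qed
  then obtain e where e: "\<And>I. set I \<subseteq> Theta3 \<Longrightarrow> e I \<in> Eset q1 q2"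
    "\<And>I j. set I \<subseteq> Theta3 \<Longrightarrow> j \<in> Theta3 \<Longrightarrow> \<tau> (I @ [j]) = enc (e I) j" by metis
  have pre: "set (prefix I n) \<subseteq> Theta3" if "\<And>n. I n \<in> Theta3" for I n
    using that by (auto simp: prefix_def)
  have step: "cls (path \<tau> I n) = e (prefix I n)" "pos (path \<tau> I n) = I n" if "\<And>n. I n \<in> Theta3" for I n
    unfolding path_def prefix_Suc e(2)[OF pre[OF that] that] by (intro cls_enc pos_enc e(1) pre that)+
  have "compat (path \<tau> I) (path \<tau> J)" if "I \<in> Theta_tau \<tau>" "J \<in> Theta_tau \<tau>" for I J
    unfolding compat_def
  proof (intro allI impI)
    fix n assume "\<forall>k<n. path \<tau> I k = path \<tau> J k"
    moreover have IJ: "I n \<in> Theta3" "J n \<in> Theta3" for n using that by (auto simp: Theta_tau_def)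
    ultimately have "prefix I n = prefix J n" using step(2) by (intro prefix_cong) metis
    then show "cls (path \<tau> I n) = cls (path \<tau> J n)" using step(1) IJ by simp
  qed
  moreover have "d \<in> path \<tau> ` Theta_tau \<tau>" if d: "d \<in> seqs" "\<forall>c\<in>path \<tau> ` Theta_tau \<tau>. compat d c" for d
  proof -
    have dG: "d n \<in> Gamma q1 q2" for n using d(1) by (simp add: seqs_def)
    define I where "I n = pos (d n)" for n
    have I: "I n \<in> Theta3" for n unfolding I_def by (intro pos_Theta3 dG)
    have dp: "d n = path \<tau> I n" for n
    proof (induction n rule: less_induct)
      case (less n)
      \<comment> \<open>\<open>I\<close> is not yet known to lie in \<open>Theta_tau\<close>, so
        \<open>d\<close> is compared with a branch \<open>J\<close> that does and that shares the
        first \<open>n\<close> letters. Condition (iii) provides it for nonempty prefixes, the zero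
        branch for \<open>n = 0\<close>.\<close>
      obtain J where J: "J \<in> Theta_tau \<tau>" "prefix J n = prefix I n"
      proof (cases n)
        case 0
        have "\<tau> (prefix (\<lambda>_. 0) (Suc m)) = 0" for m
        proof -
          have "prefix (\<lambda>_. 0) (Suc m) = replicate m 0 @ [0]" by (simp add: prefix_Suc) (simp add: prefix_def map_replicate_const)
          then show ?thesis using \<tau> by (simp add: maximal_tree_mapping_def Theta3_def vq_def zero_prod_def)
        qed
        then have "\<forall>m\<ge>1. \<tau> (prefix (\<lambda>_. 0) m) = 0" by (metis One_nat_def Suc_le_D)
        then have "(\<lambda>_. 0) \<in> Theta_tau \<tau>" by (auto simp: Theta_tau_def Theta3_def)
        then show ?thesis using that 0 by (simp add: prefix_def)
      next
        case (Suc n')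
        then have "prefix I n \<in> words" using prefix_in_words I by simp
        then obtain J N where J: "J \<in> words" "\<forall>m\<ge>N. \<tau> (prefix I n @ J @ replicate m 0) = 0"
          using \<tau> unfolding maximal_tree_mapping_def by blast
        define W where "W = prefix I n @ J"
        define L where "L k = (if k < length W then W ! k else 0)" for k
        have pL: "prefix L (length W + m) = W @ replicate m 0" for m
          by (rule nth_equalityI) (auto simp: nth_prefix L_def nth_append)
        have "\<tau> (prefix L m) = 0" if "m \<ge> length W + N" for m
        proof -
          have "prefix L m = W @ replicate (m - length W) 0" using pL[of "m - length W"] that by simp
          then show ?thesis using J(2) that by (simp add: W_def)
        qed
        moreover have "L k \<in> Theta3" for k
        proof -
          have "set W \<subseteq> Theta3" using J(1) pre[of I, OF I] by (simp add: W_def words_def)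
          then show ?thesis using nth_mem[of k W] by (cases "k < length W") (auto simp: L_def Theta3_cases subset_iff)
        qed
        ultimately have "L \<in> Theta_tau \<tau>" by (auto simp: Theta_tau_def)
        moreover have "prefix L n = prefix I n"
          by (rule prefix_cong) (simp add: L_def W_def nth_append nth_prefix)
        ultimately show ?thesis by (rule that)
      qed
      have J3: "J k \<in> Theta3" for k using J(1) by (simp add: Theta_tau_def)
      have "d k = path \<tau> J k" if "k < n" for k
      proof -
        have "prefix J (Suc k) = prefix I (Suc k)"
          by (rule prefix_cong) (use J(2) that in \<open>metis nth_prefix less_Suc_eq_le order_le_less_trans\<close>)
        then show ?thesis using less[OF that] by (simp add: path_def)
      qed
      then have "cls (d n) = cls (path \<tau> J n)" using d(2) J(1) by (auto simp: compat_def)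
      also have "\<dots> = cls (path \<tau> I n)" using J(2) by (simp add: step(1)[OF J3] step(1)[OF I])
      finally have "cls (d n) = cls (path \<tau> I n)" .
      moreover have "pos (d n) = pos (path \<tau> I n)" by (simp add: step(2)[OF I] I_def)
      moreover have "path \<tau> I n \<in> Gamma q1 q2"
        unfolding path_def by (intro mtm_Gamma[OF \<tau>] prefix_in_words I)
      ultimately show ?case using enc_cls_pos dG by metis
    qed
    from d(1) obtain N where N: "\<And>n. n \<ge> N \<Longrightarrow> d n = 0" by (rule seqsE) (rule that)
    have "\<tau> (prefix I n) = 0" if "n \<ge> Suc N" for n
      using dp[of "n - 1"] N[of "n - 1"] that by (simp add: path_def)
    then have "I \<in> Theta_tau \<tau>" using I by (auto simp: Theta_tau_def)
    moreover have "d = path \<tau> I" using dp by auto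
    ultimately show ?thesis by blast
  qed
  ultimately show ?thesis unfolding maximal_compat_def by blast
qed

section \<open>Back to orthogonal sets of the measure\<close>

lemma inj_of_int_pt: "inj of_int_pt"
  by (auto simp: inj_def of_int_pt_def prod_eq_iff)

lemma of_int_pt_diff: "of_int_pt x - of_int_pt y = of_int_pt (x - y)"
  by (simp add: of_int_pt_def)

lemma orthogonal_of_int_pt_iff:
  assumes "x \<noteq> y"
  shows "(\<integral>u. expo (of_int_pt x) u * cnj (expo (of_int_pt y) u) \<partial>mu_AD q1 q2) = 0 \<longleftrightarrow> compat (dig x) (dig y)"
proof -
  have "(\<integral>u. expo (of_int_pt x) u * cnj (expo (of_int_pt y) u) \<partial>mu_AD q1 q2) = 0 \<longleftrightarrow> zero_diff (x - y)"
    unfolding orthogonal_iff of_int_pt_diff inj_eq[OF inj_of_int_pt] by blast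
  then show ?thesis using compat_imp_zero_diff[OF _ assms] zero_diff_imp_compat by blast
qed

lemma compat_refl: "compat c c"
  by (simp add: compat_def)

text \<open>Equal points may be included because \<open>compat\<close> is reflexive; countability is
  automatic for integer points.\<close>

lemma orthogonal_set_of_int_pt:
  "orthogonal_set (mu_AD q1 q2) (of_int_pt ` L) \<longleftrightarrow> (\<forall>x\<in>L. \<forall>y\<in>L. compat (dig x) (dig y))"
proof -
  have "orthogonal_set (mu_AD q1 q2) (of_int_pt ` L) \<longleftrightarrow>
      (\<forall>x\<in>L. \<forall>y\<in>L. x \<noteq> y \<longrightarrow> compat (dig x) (dig y))"
    unfolding orthogonal_set_def using inj_of_int_pt orthogonal_of_int_pt_iff
    by (auto simp: inj_eq)
  then show ?thesis using compat_refl by metis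
qed

text \<open>As 0 belongs to the set, every other element is itself a zero of the transform, hence
  integral.\<close>

lemma orthogonal_set_integer:
  assumes "orthogonal_set (mu_AD q1 q2) \<Lambda>" "(0, 0) \<in> \<Lambda>"
  shows "\<Lambda> \<subseteq> range of_int_pt"
proof
  fix l assume l: "l \<in> \<Lambda>"
  show "l \<in> range of_int_pt"
  proof (cases "l = (0, 0)")
    case True
    then show ?thesis by (intro range_eqI[of _ _ "(0, 0)"]) (simp add: of_int_pt_def)
  next
    case False
    then have "(\<integral>x. expo l x * cnj (expo (0, 0) x) \<partial>mu_AD q1 q2) = 0"
      using assms l unfolding orthogonal_set_def by blast
    then obtain w where "l - (0, 0) = of_int_pt w" unfolding orthogonal_iff by blast
    then show ?thesis by (simp flip: zero_prod_def)
  qed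
qed

text \<open>Every competing set contains 0 as well, so it consists of integer points and is governed
  by \<open>compat\<close> on digit sequences.\<close>

lemma maximal_orthogonal_iff:
  assumes "(0, 0) \<in> \<Lambda>"
  shows "maximal_orthogonal_set (mu_AD q1 q2) \<Lambda> \<longleftrightarrow>
    \<Lambda> \<subseteq> range of_int_pt \<and> maximal_compat (dig ` {x. of_int_pt x \<in> \<Lambda>})" (is "?M \<longleftrightarrow> ?R")
proof
  define L where "L = {x. of_int_pt x \<in> \<Lambda>}"
  assume M: ?M
  then have sub: "\<Lambda> \<subseteq> range of_int_pt"
    using orthogonal_set_integer assms by (simp add: maximal_orthogonal_set_def)
  then have \<Lambda>: "\<Lambda> = of_int_pt ` L" by (auto simp: L_def)
  then have cL: "\<forall>x\<in>L. \<forall>y\<in>L. compat (dig x) (dig y)"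
    using M orthogonal_set_of_int_pt by (simp add: maximal_orthogonal_set_def)
  have "d \<in> dig ` L" if "d \<in> seqs" "\<forall>c\<in>dig ` L. compat d c" for d
  proof -
    obtain x where x: "dig x = d" using dig_surj \<open>d \<in> seqs\<close> by blast
    have "orthogonal_set (mu_AD q1 q2) (of_int_pt ` insert x L)"
      unfolding orthogonal_set_of_int_pt using cL that x compat_refl compat_sym by auto
    then have "of_int_pt ` insert x L = \<Lambda>"
      using M unfolding maximal_orthogonal_set_def \<Lambda> by blast
    then have "x \<in> L" by (auto simp: L_def)
    then show ?thesis using x by blast
  qed
  then show ?R using sub cL by (auto simp: maximal_compat_def simp flip: L_def)
next
  define L where "L = {x. of_int_pt x \<in> \<Lambda>}"
  assume R: ?R
  then have \<Lambda>: "\<Lambda> = of_int_pt ` L" by (auto simp: L_def)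
  have mc: "maximal_compat (dig ` L)" using R by (simp add: L_def)
  then have "orthogonal_set (mu_AD q1 q2) \<Lambda>"
    unfolding \<Lambda> orthogonal_set_of_int_pt by (simp add: maximal_compat_def)
  moreover have "\<Lambda>' = \<Lambda>" if o: "orthogonal_set (mu_AD q1 q2) \<Lambda>'" and sub: "\<Lambda> \<subseteq> \<Lambda>'" for \<Lambda>'
  proof -
    define L' where "L' = {x. of_int_pt x \<in> \<Lambda>'}"
    have "\<Lambda>' \<subseteq> range of_int_pt" using orthogonal_set_integer[OF o] sub assms by blast
    then have \<Lambda>': "\<Lambda>' = of_int_pt ` L'" by (auto simp: L'_def)
    have "L' \<subseteq> L"
    proof
      fix x assume x: "x \<in> L'"
      have "L \<subseteq> L'" using sub by (auto simp: L_def L'_def)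
      then have "compat (dig x) c" if "c \<in> dig ` L" for c
        using that o x unfolding \<Lambda>' orthogonal_set_of_int_pt by blast
      then have "dig x \<in> dig ` L" using mc dig_seqs by (simp add: maximal_compat_def)
      then show "x \<in> L" using inj_dig by (auto dest: injD)
    qed
    then show ?thesis using sub unfolding \<Lambda> \<Lambda>' by blast
  qed
  ultimately show ?M by (simp add: maximal_orthogonal_set_def)
qed

lemma Amat_funpow: "(Amat q1 q2 ^^ k) y = ((3 * of_int q1) ^ k * fst y, (3 * of_int q2) ^ k * snd y)"
  by (induction k) (auto simp: Amat_def)

text \<open>The digits vanish from some place on, so the series is the finite expansion of
  \<open>x\<close>.\<close>

lemma tau_star_eq:
  assumes "path \<tau> I = dig x"
  shows "tau_star q1 q2 \<tau> I = of_int_pt x"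
proof -
  obtain N where N: "\<And>n. n \<ge> N \<Longrightarrow> dig x n = 0"
    "(quo (3 * q1) ^^ N) (fst x) = 0" "(quo (3 * q2) ^^ N) (snd x) = 0"
    using dig_eventually_0 by (metis order_refl)
  have "tau_star q1 q2 \<tau> I = (\<Sum>k. (Amat q1 q2 ^^ k) (of_int_pt (dig x k)))"
    by (simp add: tau_star_def path_def flip: assms)
  also have "\<dots> = (\<Sum>k<N. (Amat q1 q2 ^^ k) (of_int_pt (dig x k)))"
    by (rule suminf_finite) (auto simp: N Amat_funpow of_int_pt_def zero_prod_def)
  also have "\<dots> = of_int_pt ((\<Sum>k<N. (3 * q1) ^ k * digit (3 * q1) (fst x) k), (\<Sum>k<N. (3 * q2) ^ k * digit (3 * q2) (snd x) k))"
    by (simp add: prod_eq_iff fst_sum snd_sum Amat_funpow of_int_pt_def dig_def)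
  also have "\<dots> = of_int_pt x"
    using digit_expansion[of "fst x" "3 * q1" N] digit_expansion[of "snd x" "3 * q2" N] N(2,3) by simp
  finally show ?thesis .
qed

lemma tau_star_image_iff:
  assumes "maximal_tree_mapping q1 q2 \<tau>"
  shows "\<Lambda> = tau_star q1 q2 \<tau> ` Theta_tau \<tau> \<longleftrightarrow>
    \<Lambda> \<subseteq> range of_int_pt \<and> dig ` {x. of_int_pt x \<in> \<Lambda>} = path \<tau> ` Theta_tau \<tau>"
proof -
  define L where "L = {x. dig x \<in> path \<tau> ` Theta_tau \<tau>}"
  have img: "tau_star q1 q2 \<tau> ` Theta_tau \<tau> = of_int_pt ` L"
  proof (intro equalityI subsetI)
    fix y assume "y \<in> tau_star q1 q2 \<tau> ` Theta_tau \<tau>"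
    then obtain I where I: "I \<in> Theta_tau \<tau>" "y = tau_star q1 q2 \<tau> I" by blast
    obtain x where "dig x = path \<tau> I" using dig_surj path_seqs[OF assms I(1)] by blast
    then show "y \<in> of_int_pt ` L" using I tau_star_eq[of \<tau> I x] by (auto simp: L_def)
  next
    fix y assume "y \<in> of_int_pt ` L"
    then obtain x I where "y = of_int_pt x" "I \<in> Theta_tau \<tau>" "path \<tau> I = dig x" by (auto simp: L_def)
    then show "y \<in> tau_star q1 q2 \<tau> ` Theta_tau \<tau>" using tau_star_eq by (metis image_eqI)
  qed
  have "c \<in> dig ` L" if c: "c \<in> path \<tau> ` Theta_tau \<tau>" for c
  proof -
    from c obtain x where "dig x = c" using dig_surj path_seqs[OF assms] by blast
    then show ?thesis using c by (auto simp: L_def)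
  qed
  then have dL: "dig ` L = path \<tau> ` Theta_tau \<tau>" by (auto simp: L_def)
  show ?thesis
  proof
    assume "\<Lambda> = tau_star q1 q2 \<tau> ` Theta_tau \<tau>"
    then have \<Lambda>: "\<Lambda> = of_int_pt ` L" by (simp only: img)
    then have "{x. of_int_pt x \<in> \<Lambda>} = L" by (simp add: inj_image_mem_iff[OF inj_of_int_pt])
    then show "\<Lambda> \<subseteq> range of_int_pt \<and> dig ` {x. of_int_pt x \<in> \<Lambda>} = path \<tau> ` Theta_tau \<tau>"
      using \<Lambda> dL by blast
  next
    assume R: "\<Lambda> \<subseteq> range of_int_pt \<and> dig ` {x. of_int_pt x \<in> \<Lambda>} = path \<tau> ` Theta_tau \<tau>"
    then have "dig ` {x. of_int_pt x \<in> \<Lambda>} = dig ` L" using dL by simp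
    then have "{x. of_int_pt x \<in> \<Lambda>} = L" unfolding inj_image_eq_iff[OF inj_dig] .
    moreover have "\<Lambda> = of_int_pt ` {x. of_int_pt x \<in> \<Lambda>}" using R by auto
    ultimately show "\<Lambda> = tau_star q1 q2 \<tau> ` Theta_tau \<tau>" unfolding img by simp
  qed
qed

text \<open>Both sides reduce to integrality of \<open>\<Lambda>\<close> together with a condition
  on its digit sequences \<open>?C\<close>, which contain the zero sequence because 0 lies in
  \<open>\<Lambda>\<close>.\<close>

lemma maximal_orthogonal_set_iff_tree:
  assumes "(0, 0) \<in> \<Lambda>"
  shows "maximal_orthogonal_set (mu_AD q1 q2) \<Lambda> \<longleftrightarrow>
    (\<exists>\<tau>. maximal_tree_mapping q1 q2 \<tau> \<and> \<Lambda> = tau_star q1 q2 \<tau> ` Theta_tau \<tau>)"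
proof -
  let ?C = "dig ` {x. of_int_pt x \<in> \<Lambda>}"
  have "dig (0, 0) = (\<lambda>_. 0)"
  proof -
    have "(quo b ^^ n) 0 = 0" if "b > 0" for b n using quo_0[OF that] by (induction n) auto
    then show ?thesis using q1 q2 by (auto simp: dig_def digit_def bal_id zero_prod_def)
  qed
  moreover have "(0, 0) \<in> {x. of_int_pt x \<in> \<Lambda>}" using assms by (simp add: of_int_pt_def)
  ultimately have "(\<lambda>_. 0) \<in> ?C" by (metis image_eqI)
  moreover have "?C \<subseteq> seqs" using dig_seqs by blast
  ultimately have mc: "maximal_compat ?C \<longleftrightarrow> (\<exists>\<tau>. maximal_tree_mapping q1 q2 \<tau> \<and> ?C = path \<tau> ` Theta_tau \<tau>)"
    using maximal_compat_imp_tree[of ?C] tree_imp_maximal_compat by auto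
  show ?thesis unfolding maximal_orthogonal_iff[OF assms] mc
    by (simp only: tau_star_image_iff cong: conj_cong) blast
qed

end

theorem theorem1p1:
  fixes q1 q2 :: int and \<Lambda> :: "(real \<times> real) set"
  assumes "1 \<le> q1" and "q1 \<le> q2"
    and "countable \<Lambda>" and "(0, 0) \<in> \<Lambda>"
  shows "maximal_orthogonal_set (mu_AD q1 q2) \<Lambda> \<longleftrightarrow>
    (\<exists>\<tau>. maximal_tree_mapping q1 q2 \<tau> \<and> \<Lambda> = tau_star q1 q2 \<tau> ` Theta_tau \<tau>)"
proof -
  interpret sierpinski q1 q2 using assms(1,2) by unfold_locales auto
  show ?thesis using assms(4) by (rule maximal_orthogonal_set_iff_tree)
qed

end
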